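(* If $\mathcal{C}$ is a left $*$-autonomous monoidal category and $G$ is a left $*$-autonomous monoidal comonad on $\mathcal{C}$, then the monoidal category $\mathcal{C}^G$ of Eilenberg-Moore $G$-coalgebras is left $*$-autonomous and the strict monoidal underlying functor $U:\mathcal{C}^G\to\mathcal{C}$ preserves left internal homs. If $\mathcal{C}$ is $*$-autonomous then so is $\mathcal{C}^G$, and $U$ preserves left and right internal homs.
   Context: Monoidal categories are written as if strict. A left internal hom of $B,E$ is an object ${}^B E$ representing $\mathcal{C}(-\otimes B,E)$; a right internal hom is an object $E^A$ representing $\mathcal{C}(A\otimes -,E)$. An object $D$ of $\mathcal{C}$ is a left raiser when for every $B$ there is a chosen object ${}^B D$ with isomorphisms $\varpi_{A,B}:\mathcal{C}(A,{}^B D)\to\mathcal{C}(A\otimes B,D)$ natural in $A$. Then $S:\mathcal{C}^{\mathrm{op}}\to\mathcal{C}$ is the unique functor with $SB={}^B D$ making $\varpi$ natural in $B$ too; one chooses $SI=D$, $\varpi_{A,I}=1$. Put $\omega_{A,B,C}=\varpi_{A\otimes B,C}^{-1}\circ\varpi_{A,B\otimes C}$; $e_{B,C}=\omega_{S(B\otimes C),B,C}(1):S(B\otimes C)\otimes B\to SC$; $\rho_{A,B}=\omega_{I,A,B}^{-1}:\mathcal{C}(A,SB)\to\mathcal{C}(I,S(A\otimes B))$; $n_B=\rho_{SB,B}(1):I\to S(SB\otimes B)$, so $n_I:I\to SSI$. $D$ is a raiser if it is a left raiser and all right internal homs $D^A$ exist; equivalently, $S$ has a left adjoint $S':\mathcal{C}\to\mathcal{C}^{\mathrm{op}}$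 ($\mathcal{C}(A,SB)\cong\mathcal{C}(B,S'A)$, $S'A\cong D^A$), with unit $\alpha_A:A\to SS'A$ and counit $\beta_B:B\to S'SB$, both regarded as morphisms in $\mathcal{C}$. $D$ is left dualizing when it is a raiser and every $\alpha_A$ is invertible; $D$ is dualizing when it is a left raiser and $S$ is an equivalence. $\mathcal{C}$ is left $*$-autonomous (resp. $*$-autonomous) when equipped with a left dualizing (resp. dualizing) object. A monoidal comonad is a comonad $(G,\delta:G\to GG,\epsilon:G\to 1)$ whose endofunctor is (lax) monoidal via $\phi_{A,B}:GA\otimes GB\to G(A\otimes B)$, $\phi_0:I\to GI$, with $\delta,\epsilon$ monoidal natural transformations. $\mathcal{C}^G$ is the category of coalgebras $(A,\gamma:A\to GA)$, monoidal with $(A,\gamma)\otimes(B,\gamma')=(A\otimes B,\phi_{A,B}\circ(\gamma\otimes\gamma'))$ and unit $(I,\phi_0)$. A monoidal comonad $G$ on a left $*$-autonomous $\mathcal{C}$ is left $*$-autonomous when it is equipped with natural transformations $\nu_A:SA\to GSGA$ and $\nu'_A:S'A\to GS'GA$ satisfying: (1) $\epsilon_{SGA}\circ\nu_A=S(\epsilon_A)$, and the same with $(S',\nu')$ in place of $(S,\nu)$; (2) $\delta_{SGA}\circ\nu_A=GGS(\delta_A)\circ G(\nu_{GA})\circ\nu_A$, and the same with $(S',\nu')$ in place of $(S,\nu)$; (3) $\nu_B\circ e_{A,B}\circ(1\otimes\epsilon_A)=G(e_{GA,GB})\circ G(S(\phi_{A,B})\otimes 1)\circ\phi_{SG(A\otimes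 B),GA}\circ(\nu_{A\otimes B}\otimes\delta_A)$ as morphisms $S(A\otimes B)\otimes GA\to GSGB$; (4) $G(n_I)\circ\phi_0=GS(\nu_I)\circ GSGS(\phi_0)\circ\nu_{SI}\circ n_I:I\to GSSI$; (5) $GS(\nu'_A)\circ\nu_{S'GA}\circ\alpha_{GA}=G(\alpha_A):GA\to GSS'A$; (6) $GS'(\nu_A)\circ\nu'_{SGA}\circ\beta_{GA}=G(\beta_A):GA\to GS'SA$. If $\mathcal{C}$ is $*$-autonomous, $G$ is called $*$-autonomous when it is left $*$-autonomous. *)

theory Defs
  imports Main
begin

section \<open>Categories, functors, natural transformations\<close>

record ('o, 'a) category =
  Ob :: "'o set"
  Ar :: "'a set"
  source :: "'a \<Rightarrow> 'o"
  target :: "'a \<Rightarrow> 'o"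
  ident :: "'o \<Rightarrow> 'a" ("\<one>\<index>")
  cmp :: "'a \<Rightarrow> 'a \<Rightarrow> 'a" (infixr "\<cdot>\<index>" 55)

definition hom :: "('o, 'a, 'x) category_scheme \<Rightarrow> 'o \<Rightarrow> 'o \<Rightarrow> 'a set" where
  "hom C A B = {f \<in> Ar C. source C f = A \<and> target C f = B}"

locale category =
  fixes C :: "('o, 'a, 'x) category_scheme" (structure)
  assumes source_Ob: "f \<in> Ar C \<Longrightarrow> source C f \<in> Ob C"
    and target_Ob: "f \<in> Ar C \<Longrightarrow> target C f \<in> Ob C"
    and ident_hom: "A \<in> Ob C \<Longrightarrow> \<one> A \<in> hom C A A"
    and cmp_hom: "\<lbrakk>f \<in> hom C A B; g \<in> hom C B E\<rbrakk> \<Longrightarrow> g \<cdot> f \<in> hom C A E"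
    and ident_left: "f \<in> hom C A B \<Longrightarrow> \<one> B \<cdot> f = f"
    and ident_right: "f \<in> hom C A B \<Longrightarrow> f \<cdot> \<one> A = f"
    and cmp_assoc: "\<lbrakk>f \<in> hom C A B; g \<in> hom C B E; h \<in> hom C E F\<rbrakk>
      \<Longrightarrow> (h \<cdot> g) \<cdot> f = h \<cdot> (g \<cdot> f)"

definition inverse_arrows :: "('o, 'a, 'x) category_scheme \<Rightarrow> 'a \<Rightarrow> 'a \<Rightarrow> bool" where
  "inverse_arrows C f g \<longleftrightarrow> f \<in> Ar C \<and> g \<in> hom C (target C f) (source C f)
     \<and> g \<cdot>\<^bsub>C\<^esub> f = \<one>\<^bsub>C\<^esub> (source C f) \<and> f \<cdot>\<^bsub>C\<^esub> g = \<one>\<^bsub>C\<^esub> (target C f)"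

definition invertible :: "('o, 'a, 'x) category_scheme \<Rightarrow> 'a \<Rightarrow> bool" where
  "invertible C f \<longleftrightarrow> (\<exists>g. inverse_arrows C f g)"

definition inv_arrow :: "('o, 'a, 'x) category_scheme \<Rightarrow> 'a \<Rightarrow> 'a" where
  "inv_arrow C f = (THE g. inverse_arrows C f g)"

definition opposite :: "('o, 'a, 'x) category_scheme \<Rightarrow> ('o, 'a) category" where
  "opposite C = \<lparr>Ob = Ob C, Ar = Ar C, source = target C, target = source C,
     ident = ident C, cmp = (\<lambda>g f. f \<cdot>\<^bsub>C\<^esub> g)\<rparr>"

locale cat_functor = A: category A + B: category B
  for A :: "('o, 'a, 'x) category_scheme" and B :: "('p, 'b, 'y) category_scheme" +
  fixes Fo :: "'o \<Rightarrow> 'p" and Fa :: "'a \<Rightarrow> 'b"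
  assumes map_Ob: "X \<in> Ob A \<Longrightarrow> Fo X \<in> Ob B"
    and map_hom: "f \<in> hom A X Y \<Longrightarrow> Fa f \<in> hom B (Fo X) (Fo Y)"
    and map_ident: "X \<in> Ob A \<Longrightarrow> Fa (\<one>\<^bsub>A\<^esub> X) = \<one>\<^bsub>B\<^esub> (Fo X)"
    and map_cmp: "\<lbrakk>f \<in> hom A X Y; g \<in> hom A Y Z\<rbrakk> \<Longrightarrow> Fa (g \<cdot>\<^bsub>A\<^esub> f) = Fa g \<cdot>\<^bsub>B\<^esub> Fa f"

locale nat_trans = F: cat_functor A B Fo Fa + K: cat_functor A B Ko Ka
  for A :: "('o, 'a, 'x) category_scheme" and B :: "('p, 'b, 'y) category_scheme"
    and Fo Fa Ko Ka +
  fixes \<tau> :: "'o \<Rightarrow> 'b"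
  assumes component_hom: "X \<in> Ob A \<Longrightarrow> \<tau> X \<in> hom B (Fo X) (Ko X)"
    and naturality: "f \<in> hom A X Y \<Longrightarrow> \<tau> Y \<cdot>\<^bsub>B\<^esub> Fa f = Ka f \<cdot>\<^bsub>B\<^esub> \<tau> X"

locale nat_iso = nat_trans +
  assumes component_invertible: "X \<in> Ob A \<Longrightarrow> invertible B (\<tau> X)"

definition equivalence_functor ::
  "('o, 'a, 'x) category_scheme \<Rightarrow> ('p, 'b, 'y) category_scheme \<Rightarrow> ('o \<Rightarrow> 'p) \<Rightarrow> ('a \<Rightarrow> 'b) \<Rightarrow> bool"
  where "equivalence_functor A B Fo Fa \<longleftrightarrow> cat_functor A B Fo Fa \<and>
    (\<exists>Ko Ka \<eta> \<theta>. cat_functor B A Ko Ka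
       \<and> nat_iso A A (\<lambda>X. X) (\<lambda>f. f) (\<lambda>X. Ko (Fo X)) (\<lambda>f. Ka (Fa f)) \<eta>
       \<and> nat_iso B B (\<lambda>Y. Fo (Ko Y)) (\<lambda>g. Fa (Ka g)) (\<lambda>Y. Y) (\<lambda>g. g) \<theta>)"


section \<open>Monoidal categories\<close>

record ('o, 'a) moncat = "('o, 'a) category" +
  tensor :: "'o \<Rightarrow> 'o \<Rightarrow> 'o" (infixr "\<otimes>\<index>" 70)
  tensor_arr :: "'a \<Rightarrow> 'a \<Rightarrow> 'a" (infixr "\<boxtimes>\<index>" 70)
  tensor_unit :: "'o" ("\<I>\<index>")
  assoc :: "'o \<Rightarrow> 'o \<Rightarrow> 'o \<Rightarrow> 'a"
  lunit :: "'o \<Rightarrow> 'a"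
  runit :: "'o \<Rightarrow> 'a"

locale monoidal_category = category C
  for C :: "('o, 'a, 'x) moncat_scheme" (structure) +
  assumes unit_Ob: "\<I> \<in> Ob C"
    and tensor_Ob: "\<lbrakk>A \<in> Ob C; B \<in> Ob C\<rbrakk> \<Longrightarrow> A \<otimes> B \<in> Ob C"
    and tensor_hom: "\<lbrakk>f \<in> hom C A A'; g \<in> hom C B B'\<rbrakk>
      \<Longrightarrow> f \<boxtimes> g \<in> hom C (A \<otimes> B) (A' \<otimes> B')"
    and tensor_ident: "\<lbrakk>A \<in> Ob C; B \<in> Ob C\<rbrakk> \<Longrightarrow> \<one> A \<boxtimes> \<one> B = \<one> (A \<otimes> B)"
    and interchange: "\<lbrakk>f \<in> hom C A A'; f' \<in> hom C A' A''; g \<in> hom C B B'; g' \<in> hom C B' B''\<rbrakk>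
      \<Longrightarrow> (f' \<cdot> f) \<boxtimes> (g' \<cdot> g) = (f' \<boxtimes> g') \<cdot> (f \<boxtimes> g)"
    and assoc_hom: "\<lbrakk>A \<in> Ob C; B \<in> Ob C; E \<in> Ob C\<rbrakk>
      \<Longrightarrow> assoc C A B E \<in> hom C ((A \<otimes> B) \<otimes> E) (A \<otimes> (B \<otimes> E))"
    and assoc_invertible: "\<lbrakk>A \<in> Ob C; B \<in> Ob C; E \<in> Ob C\<rbrakk> \<Longrightarrow> invertible C (assoc C A B E)"
    and assoc_natural: "\<lbrakk>f \<in> hom C A A'; g \<in> hom C B B'; h \<in> hom C E E'\<rbrakk>
      \<Longrightarrow> assoc C A' B' E' \<cdot> ((f \<boxtimes> g) \<boxtimes> h) = (f \<boxtimes> (g \<boxtimes> h)) \<cdot> assoc C A B E"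
    and lunit_hom: "A \<in> Ob C \<Longrightarrow> lunit C A \<in> hom C (\<I> \<otimes> A) A"
    and lunit_invertible: "A \<in> Ob C \<Longrightarrow> invertible C (lunit C A)"
    and lunit_natural: "f \<in> hom C A A' \<Longrightarrow> lunit C A' \<cdot> (\<one> \<I> \<boxtimes> f) = f \<cdot> lunit C A"
    and runit_hom: "A \<in> Ob C \<Longrightarrow> runit C A \<in> hom C (A \<otimes> \<I>) A"
    and runit_invertible: "A \<in> Ob C \<Longrightarrow> invertible C (runit C A)"
    and runit_natural: "f \<in> hom C A A' \<Longrightarrow> runit C A' \<cdot> (f \<boxtimes> \<one> \<I>) = f \<cdot> runit C A"
    and pentagon: "\<lbrakk>A \<in> Ob C; B \<in> Ob C; E \<in> Ob C; F \<in> Ob C\<rbrakk>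
      \<Longrightarrow> assoc C A B (E \<otimes> F) \<cdot> assoc C (A \<otimes> B) E F
        = (\<one> A \<boxtimes> assoc C B E F) \<cdot> assoc C A (B \<otimes> E) F \<cdot> (assoc C A B E \<boxtimes> \<one> F)"
    and triangle: "\<lbrakk>A \<in> Ob C; B \<in> Ob C\<rbrakk>
      \<Longrightarrow> (\<one> A \<boxtimes> lunit C B) \<cdot> assoc C A \<I> B = runit C A \<boxtimes> \<one> B"

locale strict_monoidal_functor =
  M: monoidal_category M + N: monoidal_category N + cat_functor M N Fo Fa
  for M :: "('o, 'a, 'x) moncat_scheme" and N :: "('p, 'b, 'y) moncat_scheme" and Fo Fa +
  assumes strict_tensor: "\<lbrakk>A \<in> Ob M; B \<in> Ob M\<rbrakk> \<Longrightarrow> Fo (A \<otimes>\<^bsub>M\<^esub> B) = Fo A \<otimes>\<^bsub>N\<^esub> Fo B"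
    and strict_tensor_arr: "\<lbrakk>f \<in> Ar M; g \<in> Ar M\<rbrakk> \<Longrightarrow> Fa (f \<boxtimes>\<^bsub>M\<^esub> g) = Fa f \<boxtimes>\<^bsub>N\<^esub> Fa g"
    and strict_unit: "Fo \<I>\<^bsub>M\<^esub> = \<I>\<^bsub>N\<^esub>"
    and strict_assoc: "\<lbrakk>A \<in> Ob M; B \<in> Ob M; E \<in> Ob M\<rbrakk>
      \<Longrightarrow> Fa (assoc M A B E) = assoc N (Fo A) (Fo B) (Fo E)"
    and strict_lunit: "A \<in> Ob M \<Longrightarrow> Fa (lunit M A) = lunit N (Fo A)"
    and strict_runit: "A \<in> Ob M \<Longrightarrow> Fa (runit M A) = runit N (Fo A)"


section \<open>Internal homs\<close>

text \<open>A representation of \<open>C(- \<otimes> B, E)\<close>, respectively of \<open>C(A \<otimes> -, E)\<close>, by \<open>H\<close>.\<close>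

definition left_internal_hom ::
  "('o, 'a, 'x) moncat_scheme \<Rightarrow> 'o \<Rightarrow> 'o \<Rightarrow> 'o \<Rightarrow> ('o \<Rightarrow> 'a \<Rightarrow> 'a) \<Rightarrow> bool" where
  "left_internal_hom C B E H \<psi> \<longleftrightarrow> B \<in> Ob C \<and> E \<in> Ob C \<and> H \<in> Ob C
     \<and> (\<forall>A \<in> Ob C. bij_betw (\<psi> A) (hom C A H) (hom C (A \<otimes>\<^bsub>C\<^esub> B) E))
     \<and> (\<forall>A A' h f. h \<in> hom C A' A \<longrightarrow> f \<in> hom C A H
          \<longrightarrow> \<psi> A' (f \<cdot>\<^bsub>C\<^esub> h) = \<psi> A f \<cdot>\<^bsub>C\<^esub> (h \<boxtimes>\<^bsub>C\<^esub> \<one>\<^bsub>C\<^esub> B))"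

definition right_internal_hom ::
  "('o, 'a, 'x) moncat_scheme \<Rightarrow> 'o \<Rightarrow> 'o \<Rightarrow> 'o \<Rightarrow> ('o \<Rightarrow> 'a \<Rightarrow> 'a) \<Rightarrow> bool" where
  "right_internal_hom C A E H \<psi> \<longleftrightarrow> A \<in> Ob C \<and> E \<in> Ob C \<and> H \<in> Ob C
     \<and> (\<forall>B \<in> Ob C. bij_betw (\<psi> B) (hom C B H) (hom C (A \<otimes>\<^bsub>C\<^esub> B) E))
     \<and> (\<forall>B B' h f. h \<in> hom C B' B \<longrightarrow> f \<in> hom C B H
          \<longrightarrow> \<psi> B' (f \<cdot>\<^bsub>C\<^esub> h) = \<psi> B f \<cdot>\<^bsub>C\<^esub> (\<one>\<^bsub>C\<^esub> A \<boxtimes>\<^bsub>C\<^esub> h))"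

text \<open>A strict monoidal functor preserves an internal hom when it takes the representing
  object, together with its evaluation \<open>\<psi> H (\<one> H)\<close>, to an internal hom with its evaluation.\<close>

definition preserves_left_internal_homs ::
  "('o, 'a, 'x) moncat_scheme \<Rightarrow> ('p, 'b, 'y) moncat_scheme \<Rightarrow> ('o \<Rightarrow> 'p) \<Rightarrow> ('a \<Rightarrow> 'b) \<Rightarrow> bool" where
  "preserves_left_internal_homs M N Fo Fa \<longleftrightarrow>
     (\<forall>B E H \<psi>. left_internal_hom M B E H \<psi> \<longrightarrow>
        (\<exists>\<psi>'. left_internal_hom N (Fo B) (Fo E) (Fo H) \<psi>'
           \<and> \<psi>' (Fo H) (\<one>\<^bsub>N\<^esub> (Fo H)) = Fa (\<psi> H (\<one>\<^bsub>M\<^esub> H))))"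

definition preserves_right_internal_homs ::
  "('o, 'a, 'x) moncat_scheme \<Rightarrow> ('p, 'b, 'y) moncat_scheme \<Rightarrow> ('o \<Rightarrow> 'p) \<Rightarrow> ('a \<Rightarrow> 'b) \<Rightarrow> bool" where
  "preserves_right_internal_homs M N Fo Fa \<longleftrightarrow>
     (\<forall>A E H \<psi>. right_internal_hom M A E H \<psi> \<longrightarrow>
        (\<exists>\<psi>'. right_internal_hom N (Fo A) (Fo E) (Fo H) \<psi>'
           \<and> \<psi>' (Fo H) (\<one>\<^bsub>N\<^esub> (Fo H)) = Fa (\<psi> H (\<one>\<^bsub>M\<^esub> H))))"


section \<open>Raisers and star-autonomous categories\<close>

text \<open>\<open>S B\<close> is the chosen left internal hom of \<open>B\<close> and \<open>D\<close>. The convention that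
  \<open>\<pi> A I\<close> is the identity becomes composition with the right unit isomorphism when the
  monoidal category is not strict.\<close>

locale left_raiser = monoidal_category C
  for C :: "('o, 'a, 'x) moncat_scheme" (structure) +
  fixes D :: 'o and S :: "'o \<Rightarrow> 'o" and \<pi> :: "'o \<Rightarrow> 'o \<Rightarrow> 'a \<Rightarrow> 'a"
  assumes D_Ob: "D \<in> Ob C"
    and S_internal_hom: "B \<in> Ob C \<Longrightarrow> left_internal_hom C B D (S B) (\<lambda>A. \<pi> A B)"
    and S_unit: "S \<I> = D"
    and \<pi>_unit: "f \<in> hom C A D \<Longrightarrow> \<pi> A \<I> f = f \<cdot> runit C A"
begin

text \<open>The inverse of \<open>\<pi> A B\<close>.\<close>

definition transpose :: "'o \<Rightarrow> 'o \<Rightarrow> 'a \<Rightarrow> 'a" where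
  "transpose A B = the_inv_into (hom C A (S B)) (\<pi> A B)"

text \<open>The effect on \<open>k : B \<rightarrow> B'\<close> of the functor \<open>S\<close>: naturality of \<open>\<pi>\<close> in its second
  argument, \<open>\<pi> A B (S k \<cdot> f) = \<pi> A B' f \<cdot> (\<one> A \<boxtimes> k)\<close>, forces this value
  on taking \<open>A = S B'\<close> and \<open>f = \<one> A\<close>.\<close>

definition S_arr :: "'a \<Rightarrow> 'a" where
  "S_arr k = (let B = source C k; B' = target C k in
     transpose (S B') B (\<pi> (S B') B' (\<one> (S B')) \<cdot> (\<one> (S B') \<boxtimes> k)))"

text \<open>In a strict monoidal category the unit and associativity isomorphisms below are identities.\<close>

definition \<omega> :: "'o \<Rightarrow> 'o \<Rightarrow> 'o \<Rightarrow> 'a \<Rightarrow> 'a" where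
  "\<omega> A B E f = transpose (A \<otimes> B) E (\<pi> A (B \<otimes> E) f \<cdot> assoc C A B E)"

definition e :: "'o \<Rightarrow> 'o \<Rightarrow> 'a" where
  "e B E = \<omega> (S (B \<otimes> E)) B E (\<one> (S (B \<otimes> E)))"

definition \<rho> :: "'o \<Rightarrow> 'o \<Rightarrow> 'a \<Rightarrow> 'a" where
  "\<rho> A B f = the_inv_into (hom C \<I> (S (A \<otimes> B))) (\<omega> \<I> A B) (f \<cdot> lunit C A)"

definition n :: "'o \<Rightarrow> 'a" where
  "n B = \<rho> (S B) B (\<one> (S B))"

text \<open>\<open>n \<I>\<close> has codomain \<open>S (S \<I> \<otimes> \<I>)\<close>; this is its version \<open>\<I> \<rightarrow> S (S \<I>)\<close>.\<close>

definition n_unit :: 'a where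
  "n_unit = S_arr (inv_arrow C (runit C (S \<I>))) \<cdot> n \<I>"

end

text \<open>\<open>S' A\<close> is the right internal hom of \<open>A\<close> and \<open>D\<close>; the adjunction between \<open>S\<close> and \<open>S'\<close>
  is \<open>C(A, S B) \<cong> C(A \<otimes> B, D) \<cong> C(B, S' A)\<close>.\<close>

locale raiser = left_raiser C D S \<pi>
  for C :: "('o, 'a, 'x) moncat_scheme" (structure) and D S \<pi> +
  fixes S' :: "'o \<Rightarrow> 'o" and \<pi>' :: "'o \<Rightarrow> 'o \<Rightarrow> 'a \<Rightarrow> 'a"
  assumes S'_internal_hom: "A \<in> Ob C \<Longrightarrow> right_internal_hom C A D (S' A) (\<pi>' A)"
begin

definition transpose' :: "'o \<Rightarrow> 'o \<Rightarrow> 'a \<Rightarrow> 'a" where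
  "transpose' A B = the_inv_into (hom C B (S' A)) (\<pi>' A B)"

definition S'_arr :: "'a \<Rightarrow> 'a" where
  "S'_arr k = (let A = source C k; A' = target C k in
     transpose' A (S' A') (\<pi>' A' (S' A') (\<one> (S' A')) \<cdot> (k \<boxtimes> \<one> (S' A'))))"

definition \<alpha> :: "'o \<Rightarrow> 'a" where
  "\<alpha> A = transpose A (S' A) (\<pi>' A (S' A) (\<one> (S' A)))"

definition \<beta> :: "'o \<Rightarrow> 'a" where
  "\<beta> B = transpose' (S B) B (\<pi> (S B) B (\<one> (S B)))"

end

locale left_dualizing = raiser +
  assumes \<alpha>_invertible: "A \<in> Ob C \<Longrightarrow> invertible C (\<alpha> A)"

locale dualizing = left_raiser +
  assumes S_equivalence: "equivalence_functor (opposite C) C S S_arr"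

definition left_star_autonomous :: "('o, 'a, 'x) moncat_scheme \<Rightarrow> bool" where
  "left_star_autonomous C \<longleftrightarrow> (\<exists>D S \<pi> S' \<pi>'. left_dualizing C D S \<pi> S' \<pi>')"

definition star_autonomous :: "('o, 'a, 'x) moncat_scheme \<Rightarrow> bool" where
  "star_autonomous C \<longleftrightarrow> (\<exists>D S \<pi>. dualizing C D S \<pi>)"


section \<open>Monoidal comonads and their coalgebras\<close>

locale monoidal_comonad = monoidal_category C
  + G: cat_functor C C Go Ga
  + \<delta>: nat_trans C C Go Ga "\<lambda>A. Go (Go A)" "\<lambda>f. Ga (Ga f)" \<delta>
  + \<epsilon>: nat_trans C C Go Ga "\<lambda>A. A" "\<lambda>f. f" \<epsilon>
  for C :: "('o, 'a, 'x) moncat_scheme" (structure)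
    and Go :: "'o \<Rightarrow> 'o" and Ga :: "'a \<Rightarrow> 'a" and \<delta> \<epsilon> :: "'o \<Rightarrow> 'a" +
  fixes \<phi> :: "'o \<Rightarrow> 'o \<Rightarrow> 'a" and \<phi>\<^sub>0 :: 'a
  assumes coassoc: "A \<in> Ob C \<Longrightarrow> \<delta> (Go A) \<cdot> \<delta> A = Ga (\<delta> A) \<cdot> \<delta> A"
    and counit_left: "A \<in> Ob C \<Longrightarrow> \<epsilon> (Go A) \<cdot> \<delta> A = \<one> (Go A)"
    and counit_right: "A \<in> Ob C \<Longrightarrow> Ga (\<epsilon> A) \<cdot> \<delta> A = \<one> (Go A)"
    and \<phi>_hom: "\<lbrakk>A \<in> Ob C; B \<in> Ob C\<rbrakk> \<Longrightarrow> \<phi> A B \<in> hom C (Go A \<otimes> Go B) (Go (A \<otimes> B))"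
    and \<phi>_natural: "\<lbrakk>f \<in> hom C A A'; g \<in> hom C B B'\<rbrakk>
      \<Longrightarrow> \<phi> A' B' \<cdot> (Ga f \<boxtimes> Ga g) = Ga (f \<boxtimes> g) \<cdot> \<phi> A B"
    and \<phi>\<^sub>0_hom: "\<phi>\<^sub>0 \<in> hom C \<I> (Go \<I>)"
    and \<phi>_assoc: "\<lbrakk>A \<in> Ob C; B \<in> Ob C; E \<in> Ob C\<rbrakk>
      \<Longrightarrow> Ga (assoc C A B E) \<cdot> \<phi> (A \<otimes> B) E \<cdot> (\<phi> A B \<boxtimes> \<one> (Go E))
        = \<phi> A (B \<otimes> E) \<cdot> (\<one> (Go A) \<boxtimes> \<phi> B E) \<cdot> assoc C (Go A) (Go B) (Go E)"
    and \<phi>_lunit: "A \<in> Ob C \<Longrightarrow> Ga (lunit C A) \<cdot> \<phi> \<I> A \<cdot> (\<phi>\<^sub>0 \<boxtimes> \<one> (Go A)) = lunit C (Go A)"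
    and \<phi>_runit: "A \<in> Ob C \<Longrightarrow> Ga (runit C A) \<cdot> \<phi> A \<I> \<cdot> (\<one> (Go A) \<boxtimes> \<phi>\<^sub>0) = runit C (Go A)"
    and \<delta>_tensor: "\<lbrakk>A \<in> Ob C; B \<in> Ob C\<rbrakk>
      \<Longrightarrow> \<delta> (A \<otimes> B) \<cdot> \<phi> A B = Ga (\<phi> A B) \<cdot> \<phi> (Go A) (Go B) \<cdot> (\<delta> A \<boxtimes> \<delta> B)"
    and \<delta>_unit: "\<delta> \<I> \<cdot> \<phi>\<^sub>0 = Ga \<phi>\<^sub>0 \<cdot> \<phi>\<^sub>0"
    and \<epsilon>_tensor: "\<lbrakk>A \<in> Ob C; B \<in> Ob C\<rbrakk> \<Longrightarrow> \<epsilon> (A \<otimes> B) \<cdot> \<phi> A B = \<epsilon> A \<boxtimes> \<epsilon> B"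
    and \<epsilon>_unit: "\<epsilon> \<I> \<cdot> \<phi>\<^sub>0 = \<one> \<I>"

definition coalgebras ::
  "('o, 'a, 'x) category_scheme \<Rightarrow> ('o \<Rightarrow> 'o) \<Rightarrow> ('a \<Rightarrow> 'a) \<Rightarrow> ('o \<Rightarrow> 'a) \<Rightarrow> ('o \<Rightarrow> 'a)
     \<Rightarrow> ('o \<times> 'a) set" where
  "coalgebras C Go Ga \<delta> \<epsilon> = {(A, \<gamma>). A \<in> Ob C \<and> \<gamma> \<in> hom C A (Go A)
     \<and> \<epsilon> A \<cdot>\<^bsub>C\<^esub> \<gamma> = \<one>\<^bsub>C\<^esub> A \<and> \<delta> A \<cdot>\<^bsub>C\<^esub> \<gamma> = Ga \<gamma> \<cdot>\<^bsub>C\<^esub> \<gamma>}"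

text \<open>An arrow \<open>(X, f, Y)\<close> of the category of coalgebras is an underlying arrow \<open>f\<close>
  together with its source and target coalgebras.\<close>

definition coalgebra_category ::
  "('o, 'a, 'x) moncat_scheme \<Rightarrow> ('o \<Rightarrow> 'o) \<Rightarrow> ('a \<Rightarrow> 'a) \<Rightarrow> ('o \<Rightarrow> 'a) \<Rightarrow> ('o \<Rightarrow> 'a)
     \<Rightarrow> ('o \<Rightarrow> 'o \<Rightarrow> 'a) \<Rightarrow> 'a \<Rightarrow> ('o \<times> 'a, ('o \<times> 'a) \<times> 'a \<times> ('o \<times> 'a)) moncat" where
  "coalgebra_category C Go Ga \<delta> \<epsilon> \<phi> \<phi>\<^sub>0 =
    (let ten = (\<lambda>(A, \<gamma>) (B, \<gamma>'). (A \<otimes>\<^bsub>C\<^esub> B, \<phi> A B \<cdot>\<^bsub>C\<^esub> (\<gamma> \<boxtimes>\<^bsub>C\<^esub> \<gamma>')));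
         un = (\<I>\<^bsub>C\<^esub>, \<phi>\<^sub>0)
     in \<lparr>Ob = coalgebras C Go Ga \<delta> \<epsilon>,
         Ar = {((A, \<gamma>), f, (B, \<gamma>')). (A, \<gamma>) \<in> coalgebras C Go Ga \<delta> \<epsilon>
                 \<and> (B, \<gamma>') \<in> coalgebras C Go Ga \<delta> \<epsilon>
                 \<and> f \<in> hom C A B \<and> Ga f \<cdot>\<^bsub>C\<^esub> \<gamma> = \<gamma>' \<cdot>\<^bsub>C\<^esub> f},
         source = (\<lambda>(X, f, Y). X),
         target = (\<lambda>(X, f, Y). Y),
         ident = (\<lambda>X. (X, \<one>\<^bsub>C\<^esub> (fst X), X)),
         cmp = (\<lambda>(Y, g, Z) (X, f, Y'). (X, g \<cdot>\<^bsub>C\<^esub> f, Z)),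
         tensor = ten,
         tensor_arr = (\<lambda>(X, f, X') (Y, g, Y'). (ten X Y, f \<boxtimes>\<^bsub>C\<^esub> g, ten X' Y')),
         tensor_unit = un,
         assoc = (\<lambda>X Y Z. (ten (ten X Y) Z, assoc C (fst X) (fst Y) (fst Z), ten X (ten Y Z))),
         lunit = (\<lambda>X. (ten un X, lunit C (fst X), X)),
         runit = (\<lambda>X. (ten X un, runit C (fst X), X))\<rparr>)"

definition underlying_obj :: "'o \<times> 'a \<Rightarrow> 'o" where
  "underlying_obj = fst"

definition underlying_arr :: "('o \<times> 'a) \<times> 'a \<times> ('o \<times> 'a) \<Rightarrow> 'a" where
  "underlying_arr = (\<lambda>(X, f, Y). f)"


section \<open>Star-autonomous monoidal comonads\<close>

text \<open>The axioms only refer to the functors \<open>S\<close>, \<open>S'\<close> and the adjunction between them; they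
  are stated over a raiser, to which left dualizing or dualizing is added separately.\<close>

locale left_star_autonomous_comonad =
  raiser C D S \<pi> S' \<pi>'
  + monoidal_comonad C Go Ga \<delta> \<epsilon> \<phi> \<phi>\<^sub>0
  + \<nu>: nat_trans "opposite C" C S S_arr "\<lambda>A. Go (S (Go A))" "\<lambda>f. Ga (S_arr (Ga f))" \<nu>
  + \<nu>': nat_trans "opposite C" C S' S'_arr "\<lambda>A. Go (S' (Go A))" "\<lambda>f. Ga (S'_arr (Ga f))" \<nu>'
  for C :: "('o, 'a, 'x) moncat_scheme" (structure)
    and D S \<pi> S' \<pi>' Go Ga \<delta> \<epsilon> \<phi> \<phi>\<^sub>0 and \<nu> \<nu>' :: "'o \<Rightarrow> 'a" +
  assumes \<nu>_counit: "A \<in> Ob C \<Longrightarrow> \<epsilon> (S (Go A)) \<cdot> \<nu> A = S_arr (\<epsilon> A)"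
    and \<nu>'_counit: "A \<in> Ob C \<Longrightarrow> \<epsilon> (S' (Go A)) \<cdot> \<nu>' A = S'_arr (\<epsilon> A)"
    and \<nu>_comult: "A \<in> Ob C
      \<Longrightarrow> \<delta> (S (Go A)) \<cdot> \<nu> A = Ga (Ga (S_arr (\<delta> A))) \<cdot> Ga (\<nu> (Go A)) \<cdot> \<nu> A"
    and \<nu>'_comult: "A \<in> Ob C
      \<Longrightarrow> \<delta> (S' (Go A)) \<cdot> \<nu>' A = Ga (Ga (S'_arr (\<delta> A))) \<cdot> Ga (\<nu>' (Go A)) \<cdot> \<nu>' A"
    and \<nu>_e: "\<lbrakk>A \<in> Ob C; B \<in> Ob C\<rbrakk>
      \<Longrightarrow> \<nu> B \<cdot> e A B \<cdot> (\<one> (S (A \<otimes> B)) \<boxtimes> \<epsilon> A)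
        = Ga (e (Go A) (Go B)) \<cdot> Ga (S_arr (\<phi> A B) \<boxtimes> \<one> (Go A))
          \<cdot> \<phi> (S (Go (A \<otimes> B))) (Go A) \<cdot> (\<nu> (A \<otimes> B) \<boxtimes> \<delta> A)"
    and \<nu>_n: "Ga n_unit \<cdot> \<phi>\<^sub>0
        = Ga (S_arr (\<nu> \<I>)) \<cdot> Ga (S_arr (Ga (S_arr \<phi>\<^sub>0))) \<cdot> \<nu> (S \<I>) \<cdot> n_unit"
    and \<nu>_\<alpha>: "A \<in> Ob C
      \<Longrightarrow> Ga (S_arr (\<nu>' A)) \<cdot> \<nu> (S' (Go A)) \<cdot> \<alpha> (Go A) = Ga (\<alpha> A)"
    and \<nu>_\<beta>: "A \<in> Ob C
      \<Longrightarrow> Ga (S'_arr (\<nu> A)) \<cdot> \<nu>' (S (Go A)) \<cdot> \<beta> (Go A) = Ga (\<beta> A)"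

end

theory Submission
  imports Defs
begin

text \<open>Write \<open>U\<close> for the underlying functor from coalgebras to \<open>C\<close>. The proof lifts the whole raiser
  structure of \<open>C\<close> along \<open>U\<close> in such a way that \<open>U\<close> preserves it strictly; everything claimed then
  follows, because \<open>U\<close> reflects isomorphisms and because internal homs are built from that structure.

  The transformation \<open>\<nu>\<close> turns a coaction \<open>\<gamma> : A \<rightarrow> G A\<close> into the coaction
  \<open>G (S \<gamma>) \<cdot> \<nu> A : S A \<rightarrow> G (S A)\<close>, and \<open>\<nu>'\<close> does the same for \<open>S'\<close>. The compatibility of \<open>\<nu>\<close> and \<open>\<nu>'\<close> with
  counit and comultiplication makes these coalgebras, and their compatibility with \<open>\<alpha>\<close> and \<open>\<beta>\<close> makes
  the unit and counit of the adjunction between \<open>S\<close> and \<open>S'\<close> coalgebra morphisms.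

  What has to be shown is that the bijection \<open>\<pi> : C(A, S B) \<cong> C(A \<otimes> B, D)\<close> and its inverse both respect
  coalgebra morphisms. In one direction \<open>\<pi> f = eval B \<cdot> (f \<otimes> 1)\<close>, and \<open>eval B\<close> is a coalgebra
  morphism because it is an instance of \<open>e\<close> (\<open>eval_eq_e\<close>), to which the axiom \<open>\<nu>_e\<close> applies
  (\<open>coalgebra_map_e\<close>). In the other direction a morphism \<open>g : A \<otimes> B \<rightarrow> D\<close> has the name
  \<open>S g \<cdot> n_unit : \<I> \<rightarrow> S (A \<otimes> B)\<close>, and the transpose of \<open>g\<close> is \<open>e A B \<cdot> (S g \<cdot> n_unit \<otimes> 1)\<close> up to a unit
  isomorphism (\<open>transpose_via_unit\<close>). This is where the axiom \<open>\<nu>_n\<close> enters: it says that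
  \<open>n_unit\<close> is a coalgebra morphism. The right internal homs \<open>S'\<close> then lift too, because
  their bijection \<open>\<pi>'\<close> is \<open>\<pi>\<close> followed by the adjunction.

  Dualizing properties concern only \<open>\<alpha>\<close> and \<open>\<beta>\<close>: a left dualizing object is a raiser with invertible \<open>\<alpha>\<close>,
  and a raiser is dualizing if and only if \<open>\<alpha>\<close> and \<open>\<beta>\<close> are both invertible
  (\<open>equivalence_imp_invertible\<close>, \<open>invertible_imp_dualizing\<close>). If \<open>\<alpha>\<close> is invertible, then
  \<open>E \<cong> S (S' E)\<close>, so that \<open>S (B \<otimes> S' E)\<close> is a left internal hom of \<open>B\<close> and \<open>E\<close>; if \<open>\<beta>\<close> is invertible, then
  \<open>S' (S E \<otimes> A)\<close> is a right internal hom of \<open>A\<close> and \<open>E\<close>. A functor that preserves the raiser structure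
  preserves these particular internal homs, hence, internal homs being unique up to isomorphism,
  all of them.\<close>

section \<open>Categories and functors\<close>

text \<open>Hom-sets are unfolded to statements about source and target: in that form the simplifier can
  check by itself that a composite is well formed, and composites can be kept associated to the
  right.\<close>

lemma hom_iff [simp]: "f \<in> hom C A B \<longleftrightarrow> f \<in> Ar C \<and> source C f = A \<and> target C f = B"
  by (auto simp: hom_def)

context category
begin

lemma source_in [simp]: "f \<in> Ar C \<Longrightarrow> source C f \<in> Ob C"
  and target_in [simp]: "f \<in> Ar C \<Longrightarrow> target C f \<in> Ob C"
  by (rule source_Ob target_Ob, assumption)+

lemma ident_typed [simp]:
  assumes "A \<in> Ob C"
  shows "\<one> A \<in> Ar C" "source C (\<one> A) = A" "target C (\<one> A) = A"
  using ident_hom[OF assms] by simp_all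

lemma cmp_typed [simp]:
  assumes "f \<in> Ar C" "g \<in> Ar C" "source C g = target C f"
  shows "g \<cdot> f \<in> Ar C" "source C (g \<cdot> f) = source C f" "target C (g \<cdot> f) = target C g"
  using cmp_hom[of f "source C f" "target C f" g "target C g"] assms by simp_all

lemma ident_cmp [simp]: "\<lbrakk>f \<in> Ar C; target C f = B\<rbrakk> \<Longrightarrow> \<one> B \<cdot> f = f"
  and cmp_ident [simp]: "\<lbrakk>f \<in> Ar C; source C f = A\<rbrakk> \<Longrightarrow> f \<cdot> \<one> A = f"
  using ident_left[of f "source C f" B] ident_right[of f A "target C f"] by simp_all

lemma cmp_assoc' [simp]:
  "\<lbrakk>f \<in> Ar C; g \<in> Ar C; h \<in> Ar C; source C g = target C f; source C h = target C g\<rbrakk>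
    \<Longrightarrow> (h \<cdot> g) \<cdot> f = h \<cdot> (g \<cdot> f)"
  using cmp_assoc[of f "source C f" "target C f" g "target C g" h "target C h"] by simp

text \<open>In composites associated to the right, an equation \<open>g \<cdot> f = k\<close> has to be applied in front of a further
  arrow.\<close>

lemma cmp_extend:
  "\<lbrakk>g \<cdot> f = k; f \<in> Ar C; g \<in> Ar C; x \<in> Ar C; source C g = target C f; source C f = target C x\<rbrakk>
    \<Longrightarrow> g \<cdot> (f \<cdot> x) = k \<cdot> x"
  using cmp_assoc'[of x f g] by simp

lemma inverse_arrows_sym: "inverse_arrows C f g \<Longrightarrow> inverse_arrows C g f"
  by (auto simp: inverse_arrows_def)

lemma inverse_arrows_unique:
  assumes "inverse_arrows C f g" "inverse_arrows C f h"
  shows "g = h"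
proof -
  have "g = g \<cdot> (f \<cdot> h)" using assms by (simp add: inverse_arrows_def)
  also have "\<dots> = (g \<cdot> f) \<cdot> h" using assms by (subst cmp_assoc') (auto simp: inverse_arrows_def)
  also have "\<dots> = h" using assms by (simp add: inverse_arrows_def)
  finally show ?thesis .
qed

lemma inv_arrow_eq: "inverse_arrows C f g \<Longrightarrow> inv_arrow C f = g"
  unfolding inv_arrow_def using inverse_arrows_unique by blast

lemma inverse_arrows_inv: "invertible C f \<Longrightarrow> inverse_arrows C f (inv_arrow C f)"
  using inv_arrow_eq by (auto simp: invertible_def)

lemma inv_typed [simp]:
  assumes "invertible C f"
  shows "inv_arrow C f \<in> Ar C" "source C (inv_arrow C f) = target C f"
    "target C (inv_arrow C f) = source C f"
  using inverse_arrows_inv[OF assms] by (simp_all add: inverse_arrows_def)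

lemma invertible_Ar: "invertible C f \<Longrightarrow> f \<in> Ar C"
  by (auto simp: invertible_def inverse_arrows_def)

lemma inv_cmp [simp]:
  assumes "invertible C f"
  shows "inv_arrow C f \<cdot> f = \<one> (source C f)" "f \<cdot> inv_arrow C f = \<one> (target C f)"
  using inverse_arrows_inv[OF assms] by (simp_all add: inverse_arrows_def)

lemma inv_cmp_extend [simp]:
  assumes "invertible C f" "x \<in> Ar C"
  shows "source C f = target C x \<Longrightarrow> inv_arrow C f \<cdot> (f \<cdot> x) = x"
    "target C f = target C x \<Longrightarrow> f \<cdot> (inv_arrow C f \<cdot> x) = x"
  using cmp_extend[OF inv_cmp(1)] cmp_extend[OF inv_cmp(2)] assms
  by (simp_all add: invertible_Ar)

lemma invertible_inv [simp]: "invertible C f \<Longrightarrow> invertible C (inv_arrow C f)"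
  using inverse_arrows_inv inverse_arrows_sym invertible_def by metis

lemma invertibleI:
  assumes "f \<in> hom C A B" "g \<in> hom C B A" "g \<cdot> f = \<one> A" "f \<cdot> g = \<one> B"
  shows "invertible C f"
  using assms unfolding invertible_def inverse_arrows_def by auto

lemma invertible_ident [simp]: "A \<in> Ob C \<Longrightarrow> invertible C (\<one> A)"
  by (rule invertibleI[of _ A A "\<one> A"]) simp_all

lemma invertible_cmp [simp]:
  assumes "invertible C f" "invertible C g" "source C g = target C f"
  shows "invertible C (g \<cdot> f)"
proof (rule invertibleI)
  show "g \<cdot> f \<in> hom C (source C f) (target C g)" using assms by (simp add: invertible_Ar)
  show "inv_arrow C f \<cdot> inv_arrow C g \<in> hom C (target C g) (source C f)" using assms by simp
qed (use assms in \<open>simp_all add: invertible_Ar\<close>)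

lemma bij_betw_inv_cmp:
  assumes "invertible C i" "i \<in> hom C E K"
  shows "bij_betw (\<lambda>f. inv_arrow C i \<cdot> f) (hom C A K) (hom C A E)"
  by (rule bij_betw_byWitness[where f' = "\<lambda>g. i \<cdot> g"]) (use assms in auto)

lemma cancel_right:
  assumes "g \<cdot> f = h \<cdot> f" "invertible C f" "g \<in> Ar C" "h \<in> Ar C"
    "source C g = target C f" "source C h = target C f"
  shows "g = h"
proof -
  have "(g \<cdot> f) \<cdot> inv_arrow C f = (h \<cdot> f) \<cdot> inv_arrow C f" using assms(1) by simp
  then show ?thesis using assms(2-) by (simp add: invertible_Ar)
qed

lemma cancel_left:
  assumes "f \<cdot> g = f \<cdot> h" "invertible C f" "g \<in> Ar C" "h \<in> Ar C"
    "source C f = target C g" "source C f = target C h"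
  shows "g = h"
proof -
  have "g = inv_arrow C f \<cdot> (f \<cdot> g)" using assms(2-) by simp
  also have "\<dots> = inv_arrow C f \<cdot> (f \<cdot> h)" using assms(1) by (rule arg_cong)
  also have "\<dots> = h" using assms(2,4,6) by simp
  finally show ?thesis .
qed

end

context cat_functor
begin

lemma Fo_in: "X \<in> Ob A \<Longrightarrow> Fo X \<in> Ob B"
  by (rule map_Ob)

lemma Fa_typed:
  assumes "f \<in> Ar A"
  shows "Fa f \<in> Ar B" "source B (Fa f) = Fo (source A f)" "target B (Fa f) = Fo (target A f)"
  using map_hom[of f "source A f" "target A f"] assms by simp_all

lemma Fa_ident: "X \<in> Ob A \<Longrightarrow> Fa (\<one>\<^bsub>A\<^esub> X) = \<one>\<^bsub>B\<^esub> (Fo X)"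
  by (rule map_ident)

lemma Fa_cmp:
  "\<lbrakk>f \<in> Ar A; g \<in> Ar A; source A g = target A f\<rbrakk> \<Longrightarrow> Fa (g \<cdot>\<^bsub>A\<^esub> f) = Fa g \<cdot>\<^bsub>B\<^esub> Fa f"
  using map_cmp[of f "source A f" "target A f" g "target A g"] by simp

lemma preserves_inverse_arrows:
  assumes "inverse_arrows A f g"
  shows "inverse_arrows B (Fa f) (Fa g)"
  using assms Fa_cmp[of f g] Fa_cmp[of g f] by (auto simp: inverse_arrows_def Fa_typed Fa_ident)

lemma preserves_invertible: "invertible A f \<Longrightarrow> invertible B (Fa f)"
  using preserves_inverse_arrows unfolding invertible_def by blast

lemma preserves_inv_arrow: "invertible A f \<Longrightarrow> Fa (inv_arrow A f) = inv_arrow B (Fa f)"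
  using B.inv_arrow_eq[OF preserves_inverse_arrows[OF A.inverse_arrows_inv]] by simp

end

lemma opposite_simps [simp]:
  "Ob (opposite C) = Ob C" "Ar (opposite C) = Ar C" "source (opposite C) = target C"
  "target (opposite C) = source C" "ident (opposite C) = ident C"
  "cmp (opposite C) g f = f \<cdot>\<^bsub>C\<^esub> g"
  by (simp_all add: opposite_def)

lemma category_opposite: "category C \<Longrightarrow> category (opposite C)"
proof -
  assume "category C"
  then interpret category C .
  show ?thesis by (rule category.intro) simp_all
qed

lemma inverse_arrows_opposite: "inverse_arrows (opposite C) f g \<longleftrightarrow> inverse_arrows C f g"
  by (auto simp: inverse_arrows_def)

lemma invertible_opposite [simp]: "invertible (opposite C) f \<longleftrightarrow> invertible C f"
  by (simp add: invertible_def inverse_arrows_opposite)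

section \<open>Monoidal categories and coherence of the units\<close>

context monoidal_category
begin

lemma unit_in [simp]: "\<I> \<in> Ob C" by (rule unit_Ob)

lemma tensor_in [simp]: "\<lbrakk>A \<in> Ob C; B \<in> Ob C\<rbrakk> \<Longrightarrow> A \<otimes> B \<in> Ob C" by (rule tensor_Ob)

lemma tensor_typed [simp]:
  assumes "f \<in> Ar C" "g \<in> Ar C"
  shows "f \<boxtimes> g \<in> Ar C" "source C (f \<boxtimes> g) = source C f \<otimes> source C g"
    "target C (f \<boxtimes> g) = target C f \<otimes> target C g"
  using tensor_hom[of f "source C f" "target C f" g "source C g" "target C g"] assms by simp_all

lemma tensor_ident' [simp]: "\<lbrakk>A \<in> Ob C; B \<in> Ob C\<rbrakk> \<Longrightarrow> \<one> A \<boxtimes> \<one> B = \<one> (A \<otimes> B)"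
  by (rule tensor_ident)

lemma assoc_typed [simp]:
  assumes "A \<in> Ob C" "B \<in> Ob C" "E \<in> Ob C"
  shows "assoc C A B E \<in> Ar C" "source C (assoc C A B E) = (A \<otimes> B) \<otimes> E"
    "target C (assoc C A B E) = A \<otimes> B \<otimes> E" "invertible C (assoc C A B E)"
  using assoc_hom[OF assms] assoc_invertible[OF assms] by simp_all

lemma unit_isos_typed [simp]:
  assumes "A \<in> Ob C"
  shows "lunit C A \<in> Ar C" "source C (lunit C A) = \<I> \<otimes> A" "target C (lunit C A) = A"
    "invertible C (lunit C A)"
    "runit C A \<in> Ar C" "source C (runit C A) = A \<otimes> \<I>" "target C (runit C A) = A"
    "invertible C (runit C A)"
  using assms lunit_hom lunit_invertible runit_hom runit_invertible by simp_all

lemma tensor_cmp: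
  assumes "f \<in> Ar C" "f' \<in> Ar C" "g \<in> Ar C" "g' \<in> Ar C"
    "source C f' = target C f" "source C g' = target C g"
  shows "(f' \<boxtimes> g') \<cdot> (f \<boxtimes> g) = (f' \<cdot> f) \<boxtimes> (g' \<cdot> g)"
  using interchange[of f "source C f" "target C f" f' "target C f'" g "source C g" "target C g" g' "target C g'"] assms
  by simp

lemma tensor_cmp_extend:
  assumes "f \<in> Ar C" "f' \<in> Ar C" "g \<in> Ar C" "g' \<in> Ar C"
    "source C f' = target C f" "source C g' = target C g"
    "x \<in> Ar C" "target C x = source C f \<otimes> source C g"
  shows "(f' \<boxtimes> g') \<cdot> ((f \<boxtimes> g) \<cdot> x) = ((f' \<cdot> f) \<boxtimes> (g' \<cdot> g)) \<cdot> x"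
  by (rule cmp_extend[OF tensor_cmp]) (use assms in simp_all)

lemma assoc_natural':
  "\<lbrakk>f \<in> Ar C; g \<in> Ar C; h \<in> Ar C\<rbrakk>
    \<Longrightarrow> assoc C (target C f) (target C g) (target C h) \<cdot> ((f \<boxtimes> g) \<boxtimes> h)
      = (f \<boxtimes> (g \<boxtimes> h)) \<cdot> assoc C (source C f) (source C g) (source C h)"
  using assoc_natural[of f "source C f" "target C f" g "source C g" "target C g" h "source C h" "target C h"]
  by simp

lemma invertible_tensor [simp]:
  assumes "invertible C f" "invertible C g"
  shows "invertible C (f \<boxtimes> g)"
  by (rule invertibleI[of _ "source C f \<otimes> source C g" "target C f \<otimes> target C g" "inv_arrow C f \<boxtimes> inv_arrow C g"])
    (use assms in \<open>simp_all add: tensor_cmp invertible_Ar\<close>)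

text \<open>Tensoring with the unit is naturally isomorphic to the identity, hence faithful. Kelly's two coherence
  identities between unit and associativity isomorphisms are obtained from the pentagon and the triangle
  by proving them first after such a tensoring.\<close>

lemma tensor_unit_right_faithful:
  assumes "f \<boxtimes> \<one> \<I> = g \<boxtimes> \<one> \<I>" and "f \<in> hom C A B" "g \<in> hom C A B"
  shows "f = g"
proof (rule cancel_right)
  show "f \<cdot> runit C A = g \<cdot> runit C A"
    using runit_natural[of f A B] runit_natural[of g A B] assms by simp
qed (use assms in auto)

lemma tensor_unit_left_faithful:
  assumes "\<one> \<I> \<boxtimes> f = \<one> \<I> \<boxtimes> g" "f \<in> hom C A B" "g \<in> hom C A B"
  shows "f = g"
proof (rule cancel_right)
  show "f \<cdot> lunit C A = g \<cdot> lunit C A"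
    using lunit_natural[of f A B] lunit_natural[of g A B] assms by simp
qed (use assms in auto)

lemma runit_tensor:
  assumes [simp]: "A \<in> Ob C" "B \<in> Ob C"
  shows "runit C (A \<otimes> B) = (\<one> A \<boxtimes> runit C B) \<cdot> assoc C A B \<I>"
proof (rule tensor_unit_right_faithful[of _ _ "(A \<otimes> B) \<otimes> \<I>" "A \<otimes> B"])
  have tr: "runit C X \<boxtimes> \<one> Y = (\<one> X \<boxtimes> lunit C Y) \<cdot> assoc C X \<I> Y"
    if "X \<in> Ob C" "Y \<in> Ob C" for X Y using triangle that by simp
  have "assoc C A B \<I> \<cdot> (runit C (A \<otimes> B) \<boxtimes> \<one> \<I>)
      = (assoc C A B \<I> \<cdot> ((\<one> A \<boxtimes> \<one> B) \<boxtimes> lunit C \<I>)) \<cdot> assoc C (A \<otimes> B) \<I> \<I>"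
    by (simp add: tr)
  also have "\<dots> = (\<one> A \<boxtimes> (\<one> B \<boxtimes> lunit C \<I>)) \<cdot> (assoc C A B (\<I> \<otimes> \<I>) \<cdot> assoc C (A \<otimes> B) \<I> \<I>)"
    using assoc_natural'[of "\<one> A" "\<one> B" "lunit C \<I>"] by (simp del: tensor_ident')
  also have "\<dots> = (\<one> A \<boxtimes> ((\<one> B \<boxtimes> lunit C \<I>) \<cdot> assoc C B \<I> \<I>)) \<cdot> assoc C A (B \<otimes> \<I>) \<I>
      \<cdot> (assoc C A B \<I> \<boxtimes> \<one> \<I>)"
    by (simp add: pentagon tensor_cmp_extend)
  also have "\<dots> = ((\<one> A \<boxtimes> (runit C B \<boxtimes> \<one> \<I>)) \<cdot> assoc C A (B \<otimes> \<I>) \<I>) \<cdot> (assoc C A B \<I> \<boxtimes> \<one> \<I>)"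
    by (simp add: triangle)
  also have "\<dots> = assoc C A B \<I> \<cdot> (((\<one> A \<boxtimes> runit C B) \<cdot> assoc C A B \<I>) \<boxtimes> \<one> \<I>)"
    using assoc_natural'[of "\<one> A" "runit C B" "\<one> \<I>", symmetric] by (simp add: tensor_cmp)
  finally show "runit C (A \<otimes> B) \<boxtimes> \<one> \<I> = ((\<one> A \<boxtimes> runit C B) \<cdot> assoc C A B \<I>) \<boxtimes> \<one> \<I>"
    by (rule cancel_left) simp_all
qed simp_all

lemma lunit_tensor:
  assumes [simp]: "A \<in> Ob C" "B \<in> Ob C"
  shows "lunit C (A \<otimes> B) \<cdot> assoc C \<I> A B = lunit C A \<boxtimes> \<one> B"
proof (rule tensor_unit_left_faithful[of _ _ "(\<I> \<otimes> A) \<otimes> B" "A \<otimes> B"])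
  let ?c = "assoc C \<I> (\<I> \<otimes> A) B \<cdot> (assoc C \<I> \<I> A \<boxtimes> \<one> B)"
  have "(\<one> \<I> \<boxtimes> (lunit C (A \<otimes> B) \<cdot> assoc C \<I> A B)) \<cdot> ?c
      = (\<one> \<I> \<boxtimes> lunit C (A \<otimes> B)) \<cdot> (assoc C \<I> \<I> (A \<otimes> B) \<cdot> assoc C (\<I> \<otimes> \<I>) A B)"
    by (simp add: pentagon tensor_cmp_extend)
  also have "\<dots> = (runit C \<I> \<boxtimes> (\<one> A \<boxtimes> \<one> B)) \<cdot> assoc C (\<I> \<otimes> \<I>) A B"
    by (simp flip: triangle)
  also have "\<dots> = assoc C \<I> A B \<cdot> ((runit C \<I> \<boxtimes> \<one> A) \<boxtimes> \<one> B)"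
    using assoc_natural'[of "runit C \<I>" "\<one> A" "\<one> B", symmetric] by (simp del: tensor_ident')
  also have "\<dots> = (assoc C \<I> A B \<cdot> ((\<one> \<I> \<boxtimes> lunit C A) \<boxtimes> \<one> B)) \<cdot> (assoc C \<I> \<I> A \<boxtimes> \<one> B)"
    by (simp add: tensor_cmp flip: triangle)
  also have "\<dots> = (\<one> \<I> \<boxtimes> (lunit C A \<boxtimes> \<one> B)) \<cdot> ?c"
    using assoc_natural'[of "\<one> \<I>" "lunit C A" "\<one> B"] by simp
  finally show "\<one> \<I> \<boxtimes> (lunit C (A \<otimes> B) \<cdot> assoc C \<I> A B) = \<one> \<I> \<boxtimes> (lunit C A \<boxtimes> \<one> B)"
    by (rule cancel_right) simp_all
qed simp_all

end

section \<open>Representations\<close>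

text \<open>A representation of \<open>A \<mapsto> C(T A, E)\<close> for a functor \<open>T\<close>. Left and right internal homs are the cases
  \<open>T = - \<otimes> B\<close> and \<open>T = A \<otimes> -\<close>, so that uniqueness and preservation can be treated once.\<close>

definition represents ::
  "('o, 'a, 'x) category_scheme \<Rightarrow> ('o \<Rightarrow> 'o) \<Rightarrow> ('a \<Rightarrow> 'a) \<Rightarrow> 'o \<Rightarrow> 'o
     \<Rightarrow> ('o \<Rightarrow> 'a \<Rightarrow> 'a) \<Rightarrow> bool" where
  "represents C To Ta E H \<psi> \<longleftrightarrow> H \<in> Ob C
     \<and> (\<forall>A \<in> Ob C. bij_betw (\<psi> A) (hom C A H) (hom C (To A) E))
     \<and> (\<forall>A A' h f. h \<in> hom C A' A \<longrightarrow> f \<in> hom C A H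
          \<longrightarrow> \<psi> A' (f \<cdot>\<^bsub>C\<^esub> h) = \<psi> A f \<cdot>\<^bsub>C\<^esub> Ta h)"

lemma left_internal_hom_iff:
  "left_internal_hom C B E H \<psi> \<longleftrightarrow> B \<in> Ob C \<and> E \<in> Ob C
     \<and> represents C (\<lambda>A. A \<otimes>\<^bsub>C\<^esub> B) (\<lambda>h. h \<boxtimes>\<^bsub>C\<^esub> \<one>\<^bsub>C\<^esub> B) E H \<psi>"
  unfolding left_internal_hom_def represents_def by blast

lemma right_internal_hom_iff:
  "right_internal_hom C A E H \<psi> \<longleftrightarrow> A \<in> Ob C \<and> E \<in> Ob C
     \<and> represents C (\<lambda>B. A \<otimes>\<^bsub>C\<^esub> B) (\<lambda>h. \<one>\<^bsub>C\<^esub> A \<boxtimes>\<^bsub>C\<^esub> h) E H \<psi>"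
  unfolding right_internal_hom_def represents_def by blast

context category
begin

lemma represents_in: "represents C To Ta E H \<psi> \<Longrightarrow> H \<in> Ob C"
  by (simp add: represents_def)

lemma represents_bij:
  "represents C To Ta E H \<psi> \<Longrightarrow> A \<in> Ob C \<Longrightarrow> bij_betw (\<psi> A) (hom C A H) (hom C (To A) E)"
  unfolding represents_def by blast

lemma represents_typed:
  assumes "represents C To Ta E H \<psi>" "f \<in> hom C A H"
  shows "\<psi> A f \<in> hom C (To A) E"
proof -
  have "A \<in> Ob C" using assms(2) source_in by auto
  then show ?thesis using assms(2) bij_betwE[OF represents_bij[OF assms(1)]] by blast
qed

lemma represents_inj:
  assumes "represents C To Ta E H \<psi>" "\<psi> A f = \<psi> A g" "f \<in> hom C A H" "g \<in> hom C A H"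
  shows "f = g"
proof -
  have "A \<in> Ob C" using assms(3) source_in by auto
  then show ?thesis
    using inj_onD[OF bij_betw_imp_inj_on[OF represents_bij[OF assms(1)]]] assms(2-) by blast
qed

lemma represents_surj:
  assumes "represents C To Ta E H \<psi>" "A \<in> Ob C" "g \<in> hom C (To A) E"
  obtains f where "f \<in> hom C A H" "\<psi> A f = g"
proof -
  have "g \<in> \<psi> A ` hom C A H"
    unfolding bij_betw_imp_surj_on[OF represents_bij[OF assms(1,2)]] by (rule assms(3))
  then show ?thesis using that by (elim imageE) (rule that, assumption, rule sym)
qed

lemma represents_natural:
  "\<lbrakk>represents C To Ta E H \<psi>; h \<in> hom C A' A; f \<in> hom C A H\<rbrakk>
    \<Longrightarrow> \<psi> A' (f \<cdot> h) = \<psi> A f \<cdot> Ta h"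
  unfolding represents_def by blast

text \<open>The arrows between \<open>H\<close> and \<open>K\<close> that classify each other's universal element are mutually inverse, by
  injectivity of the two representations.\<close>

lemma represents_unique:
  assumes \<psi>: "represents C To Ta E H \<psi>" and \<chi>: "represents C To Ta E K \<chi>"
  obtains i where "i \<in> hom C H K" "invertible C i" "\<chi> H i = \<psi> H (\<one> H)"
proof -
  have H: "H \<in> Ob C" "\<one> H \<in> hom C H H" and K: "K \<in> Ob C" "\<one> K \<in> hom C K K"
    using represents_in[OF \<psi>] represents_in[OF \<chi>] by simp_all
  obtain i where i: "i \<in> hom C H K" "\<chi> H i = \<psi> H (\<one> H)"
    using represents_surj[OF \<chi> H(1) represents_typed[OF \<psi> H(2)]] .
  obtain j where j: "j \<in> hom C K H" "\<psi> K j = \<chi> K (\<one> K)"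
    using represents_surj[OF \<psi> K(1) represents_typed[OF \<chi> K(2)]] .
  have ij: "i \<cdot> j \<in> hom C K K" and ji: "j \<cdot> i \<in> hom C H H" using i(1) j(1) by simp_all
  have "\<chi> K (i \<cdot> j) = \<psi> H (\<one> H) \<cdot> Ta j"
    using represents_natural[OF \<chi> j(1) i(1)] i(2) by simp
  also have "\<dots> = \<psi> K (\<one> H \<cdot> j)" using represents_natural[OF \<psi> j(1) H(2)] by simp
  also have "\<dots> = \<chi> K (\<one> K)" using j by simp
  finally have 1: "i \<cdot> j = \<one> K" by (rule represents_inj[OF \<chi> _ ij K(2)])
  have "\<psi> H (j \<cdot> i) = \<chi> K (\<one> K) \<cdot> Ta i"
    using represents_natural[OF \<psi> i(1) j(1)] j(2) by simp
  also have "\<dots> = \<chi> H (\<one> K \<cdot> i)" using represents_natural[OF \<chi> i(1) K(2)] by simp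
  also have "\<dots> = \<psi> H (\<one> H)" using i by simp
  finally have 2: "j \<cdot> i = \<one> H" by (rule represents_inj[OF \<psi> _ ji H(2)])
  show ?thesis by (rule that[OF i(1) invertibleI[OF i(1) j(1) 2 1] i(2)])
qed

lemma represents_reindex:
  assumes \<psi>: "represents C To Ta E H \<psi>" and i: "i \<in> hom C K H" "invertible C i"
  shows "represents C To Ta E K (\<lambda>A f. \<psi> A (i \<cdot> f))"
  unfolding represents_def
proof (intro conjI ballI allI impI)
  show "K \<in> Ob C" using i(1) source_in by auto
  fix A assume A: "A \<in> Ob C"
  have "bij_betw (\<lambda>f. i \<cdot> f) (hom C A K) (hom C A H)"
    by (rule bij_betw_byWitness[where f' = "\<lambda>g. inv_arrow C i \<cdot> g"]) (use i in auto)
  from bij_betw_trans[OF this represents_bij[OF \<psi> A]]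
  show "bij_betw (\<lambda>f. \<psi> A (i \<cdot> f)) (hom C A K) (hom C (To A) E)" by (simp add: comp_def)
next
  fix A A' h f assume h: "h \<in> hom C A' A" and f: "f \<in> hom C A K"
  have "i \<cdot> f \<in> hom C A H" using f i by simp
  from represents_natural[OF \<psi> h this]
  show "\<psi> A' (i \<cdot> (f \<cdot> h)) = \<psi> A (i \<cdot> f) \<cdot> Ta h" using f h i by simp
qed

end

text \<open>A functor that preserves one representation together with its universal element preserves every
  other one: the comparison isomorphism of \<open>represents_unique\<close> is again an isomorphism in the target, and
  the preserved representation can be reindexed along it.\<close>

lemma (in cat_functor) represents_preserved:
  assumes \<chi>: "represents A To Ta E K \<chi>" and \<chi>': "represents B To' Ta' (Fo E) (Fo K) \<chi>'"
    and ev: "\<chi>' (Fo K) (\<one>\<^bsub>B\<^esub> (Fo K)) = Fa (\<chi> K (\<one>\<^bsub>A\<^esub> K))"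
    and Ta: "\<And>h X Y. h \<in> hom A X Y \<Longrightarrow> Ta h \<in> hom A (To X) (To Y)"
    and FT: "\<And>h. h \<in> Ar A \<Longrightarrow> Fa (Ta h) = Ta' (Fa h)"
    and \<psi>: "represents A To Ta E H \<psi>"
  shows "\<exists>\<psi>'. represents B To' Ta' (Fo E) (Fo H) \<psi>'
    \<and> \<psi>' (Fo H) (\<one>\<^bsub>B\<^esub> (Fo H)) = Fa (\<psi> H (\<one>\<^bsub>A\<^esub> H))"
proof -
  note [simp] = Fo_in Fa_typed Fa_ident
  obtain i where i: "i \<in> hom A H K" "invertible A i" "\<chi> H i = \<psi> H (\<one>\<^bsub>A\<^esub> H)"
    by (rule A.represents_unique[OF \<psi> \<chi>])
  have K: "K \<in> Ob A" "\<one>\<^bsub>A\<^esub> K \<in> hom A K K" using A.represents_in[OF \<chi>] by simp_all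
  have Fi: "Fa i \<in> hom B (Fo H) (Fo K)" and H: "H \<in> Ob A"
    using i(1) A.represents_in[OF \<psi>] by simp_all
  have 1: "\<one>\<^bsub>B\<^esub> (Fo K) \<in> hom B (Fo K) (Fo K)" using K by simp
  have "\<chi>' (Fo H) (Fa i \<cdot>\<^bsub>B\<^esub> \<one>\<^bsub>B\<^esub> (Fo H)) = \<chi>' (Fo H) (\<one>\<^bsub>B\<^esub> (Fo K) \<cdot>\<^bsub>B\<^esub> Fa i)"
    using Fi H by simp
  also have "\<dots> = Fa (\<chi> K (\<one>\<^bsub>A\<^esub> K)) \<cdot>\<^bsub>B\<^esub> Fa (Ta i)"
    using B.represents_natural[OF \<chi>' Fi 1] ev FT i(1) by simp
  also have "\<dots> = Fa (\<chi> K (\<one>\<^bsub>A\<^esub> K) \<cdot>\<^bsub>A\<^esub> Ta i)"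
    using A.represents_typed[OF \<chi> K(2)] Ta[OF i(1)] by (simp add: Fa_cmp)
  also have "\<dots> = Fa (\<psi> H (\<one>\<^bsub>A\<^esub> H))"
    using A.represents_natural[OF \<chi> i(1) K(2)] i by simp
  finally show ?thesis
    using B.represents_reindex[OF \<chi>' Fi preserves_invertible[OF i(2)]] by blast
qed

section \<open>Left raisers\<close>

context left_raiser
begin

definition eval :: "'o \<Rightarrow> 'a" where
  "eval B = \<pi> (S B) B (\<one> (S B))"

lemma \<pi>_represents:
  "B \<in> Ob C \<Longrightarrow> represents C (\<lambda>A. A \<otimes> B) (\<lambda>h. h \<boxtimes> \<one> B) D (S B) (\<lambda>A. \<pi> A B)"
  using S_internal_hom by (simp add: left_internal_hom_iff)

lemma D_in [simp]: "D \<in> Ob C" by (rule D_Ob)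

lemma S_unit' [simp]: "S \<I> = D" by (rule S_unit)

lemma S_in [simp]: "B \<in> Ob C \<Longrightarrow> S B \<in> Ob C"
  using represents_in[OF \<pi>_represents] .

lemma \<pi>_typed [simp]:
  assumes "f \<in> Ar C" "source C f = A" "target C f = S B" "B \<in> Ob C"
  shows "\<pi> A B f \<in> Ar C" "source C (\<pi> A B f) = A \<otimes> B" "target C (\<pi> A B f) = D"
  using represents_typed[OF \<pi>_represents[OF assms(4)], of f A] assms(1-3) by simp_all

lemma \<pi>_inj:
  assumes "\<pi> A B f = \<pi> A B g" and "f \<in> hom C A (S B)" "g \<in> hom C A (S B)" "B \<in> Ob C"
  shows "f = g"
  using represents_inj[OF \<pi>_represents[OF assms(4)] assms(1-3)] .

lemma \<pi>_cmp:
  assumes "f \<in> Ar C" "h \<in> Ar C" "source C f = target C h" "target C f = S B" "B \<in> Ob C"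
    "A = source C h"
  shows "\<pi> A B (f \<cdot> h) = \<pi> (target C h) B f \<cdot> (h \<boxtimes> \<one> B)"
  using represents_natural[OF \<pi>_represents[OF assms(5)], of h A "target C h" f] assms by simp

lemma eval_typed [simp]:
  assumes "B \<in> Ob C"
  shows "eval B \<in> Ar C" "source C (eval B) = S B \<otimes> B" "target C (eval B) = D"
  using assms by (simp_all add: eval_def)

lemma \<pi>_eval:
  assumes "f \<in> Ar C" "source C f = A" "target C f = S B" "B \<in> Ob C"
  shows "\<pi> A B f = eval B \<cdot> (f \<boxtimes> \<one> B)"
  using \<pi>_cmp[of "\<one> (S B)" f B A] assms by (simp add: eval_def)

lemma \<pi>_surj:
  assumes "g \<in> hom C (A \<otimes> B) D" "A \<in> Ob C" "B \<in> Ob C"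
  obtains f where "f \<in> hom C A (S B)" "\<pi> A B f = g"
  using represents_surj[OF \<pi>_represents[OF assms(3)] assms(2,1)] .

lemma transpose_\<pi> [simp]:
  assumes "f \<in> Ar C" "source C f = A" "target C f = S B" "B \<in> Ob C"
  shows "transpose A B (\<pi> A B f) = f"
proof -
  have "A \<in> Ob C" using assms by auto
  from bij_betw_imp_inj_on[OF represents_bij[OF \<pi>_represents[OF assms(4)] this]]
  show ?thesis unfolding transpose_def by (rule the_inv_into_f_f) (use assms in simp)
qed

lemma transpose_typed [simp]:
  assumes "g \<in> Ar C" "source C g = A \<otimes> B" "target C g = D" "A \<in> Ob C" "B \<in> Ob C"
  shows "transpose A B g \<in> Ar C" "source C (transpose A B g) = A"
    "target C (transpose A B g) = S B" "\<pi> A B (transpose A B g) = g"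
proof -
  obtain f where "f \<in> hom C A (S B)" "\<pi> A B f = g" using \<pi>_surj[of g A B] assms by auto
  then show "transpose A B g \<in> Ar C" "source C (transpose A B g) = A"
    "target C (transpose A B g) = S B" "\<pi> A B (transpose A B g) = g"
    using transpose_\<pi>[of f A B] assms by auto
qed

lemma S_arr_eq: "k \<in> Ar C \<Longrightarrow> S_arr k = transpose (S (target C k)) (source C k)
    (eval (target C k) \<cdot> (\<one> (S (target C k)) \<boxtimes> k))"
  by (simp add: S_arr_def Let_def eval_def)

lemma S_arr_typed [simp]:
  assumes "k \<in> Ar C"
  shows "S_arr k \<in> Ar C" "source C (S_arr k) = S (target C k)" "target C (S_arr k) = S (source C k)"
  using assms by (simp_all add: S_arr_eq)

lemma eval_dinatural:
  assumes "k \<in> Ar C"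
  shows "eval (source C k) \<cdot> (S_arr k \<boxtimes> \<one> (source C k))
    = eval (target C k) \<cdot> (\<one> (S (target C k)) \<boxtimes> k)"
  using \<pi>_eval[of "S_arr k" "S (target C k)" "source C k"] assms by (simp add: S_arr_eq)

text \<open>Naturality of \<open>\<pi>\<close> in its second argument. Since \<open>\<pi>\<close> is injective, this determines \<open>S_arr\<close> and yields its
  functoriality.\<close>

lemma \<pi>_S_arr:
  assumes "k \<in> Ar C" "f \<in> Ar C" "source C f = A" "target C f = S (target C k)" "B = source C k"
  shows "\<pi> A B (S_arr k \<cdot> f) = \<pi> A (target C k) f \<cdot> (\<one> A \<boxtimes> k)"
proof -
  have A: "A \<in> Ob C" using assms by auto
  have "\<pi> A B (S_arr k \<cdot> f) = (eval B \<cdot> (S_arr k \<boxtimes> \<one> B)) \<cdot> (f \<boxtimes> \<one> B)"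
    using assms by (simp add: \<pi>_eval tensor_cmp)
  also have "\<dots> = (eval (target C k) \<cdot> (\<one> (S (target C k)) \<boxtimes> k)) \<cdot> (f \<boxtimes> \<one> B)"
    using eval_dinatural[OF assms(1)] assms by simp
  also have "\<dots> = \<pi> A (target C k) f \<cdot> (\<one> A \<boxtimes> k)"
    using assms A by (simp add: \<pi>_eval tensor_cmp)
  finally show ?thesis .
qed

lemma S_arr_ident [simp]:
  assumes [simp]: "A \<in> Ob C"
  shows "S_arr (\<one> A) = \<one> (S A)"
proof (rule \<pi>_inj[of "S A" A])
  have "\<pi> (S A) A (S_arr (\<one> A) \<cdot> \<one> (S A)) = \<pi> (S A) A (\<one> (S A))"
    by (subst \<pi>_S_arr) simp_all
  then show "\<pi> (S A) A (S_arr (\<one> A)) = \<pi> (S A) A (\<one> (S A))" by simp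
qed simp_all

lemma S_arr_cmp:
  assumes f: "f \<in> Ar C" and g: "g \<in> Ar C" and fg: "source C f = target C g"
  shows "S_arr (f \<cdot> g) = S_arr g \<cdot> S_arr f"
proof (rule \<pi>_inj)
  let ?X = "S (target C f)" and ?B = "source C g"
  have "\<pi> ?X ?B (S_arr (f \<cdot> g) \<cdot> \<one> ?X) = eval (target C f) \<cdot> (\<one> ?X \<boxtimes> (f \<cdot> g))"
    using assms by (subst \<pi>_S_arr) (simp_all add: eval_def)
  also have "\<dots> = (eval (target C f) \<cdot> (\<one> ?X \<boxtimes> f)) \<cdot> (\<one> ?X \<boxtimes> g)"
    using assms by (simp add: tensor_cmp)
  also have "eval (target C f) \<cdot> (\<one> ?X \<boxtimes> f) = \<pi> ?X (source C f) (S_arr f)"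
    using \<pi>_S_arr[of f "\<one> ?X" ?X "source C f"] f by (simp add: eval_def)
  also have "\<dots> \<cdot> (\<one> ?X \<boxtimes> g) = \<pi> ?X ?B (S_arr g \<cdot> S_arr f)"
    using \<pi>_S_arr[of g "S_arr f" ?X ?B] assms by simp
  finally show "\<pi> ?X ?B (S_arr (f \<cdot> g)) = \<pi> ?X ?B (S_arr g \<cdot> S_arr f)"
    using assms by simp
qed (use assms in simp_all)

lemma S_functor: "cat_functor (opposite C) C S S_arr"
  by (intro cat_functor.intro cat_functor_axioms.intro category_opposite category_axioms)
    (simp_all add: S_arr_cmp)

lemma S_arr_invertible: "invertible C f \<Longrightarrow> invertible C (S_arr f)"
  using cat_functor.preserves_invertible[OF S_functor] by simp

lemma \<pi>_\<omega>:
  assumes "f \<in> Ar C" "source C f = A" "target C f = S (B \<otimes> E)" "B \<in> Ob C" "E \<in> Ob C"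
  shows "\<omega> A B E f \<in> hom C (A \<otimes> B) (S E)"
    "\<pi> (A \<otimes> B) E (\<omega> A B E f) = \<pi> A (B \<otimes> E) f \<cdot> assoc C A B E"
  using assms source_in[OF assms(1)] by (simp_all add: \<omega>_def)

lemma \<omega>_bij:
  assumes [simp]: "A \<in> Ob C" "B \<in> Ob C" "E \<in> Ob C"
  shows "bij_betw (\<omega> A B E) (hom C A (S (B \<otimes> E))) (hom C (A \<otimes> B) (S E))"
  by (rule bij_betw_byWitness[where f' = "\<lambda>g. transpose A (B \<otimes> E) (\<pi> (A \<otimes> B) E g \<cdot> inv_arrow C (assoc C A B E))"])
    (auto simp: \<omega>_def)

lemma e_typed [simp]:
  assumes "B \<in> Ob C" "E \<in> Ob C"
  shows "e B E \<in> Ar C" "source C (e B E) = S (B \<otimes> E) \<otimes> B" "target C (e B E) = S E"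
    "\<pi> (S (B \<otimes> E) \<otimes> B) E (e B E) = eval (B \<otimes> E) \<cdot> assoc C (S (B \<otimes> E)) B E"
  using assms \<pi>_\<omega>[of "\<one> (S (B \<otimes> E))" "S (B \<otimes> E)" B E] by (simp_all add: e_def eval_def)

text \<open>By naturality of \<open>\<omega>\<close> in its first argument, \<open>\<omega>\<close> is determined by its value \<open>e\<close> at an identity.\<close>

lemma \<omega>_e:
  assumes [simp]: "f \<in> Ar C" "source C f = A" "target C f = S (B \<otimes> E)" "B \<in> Ob C" "E \<in> Ob C"
  shows "\<omega> A B E f = e B E \<cdot> (f \<boxtimes> \<one> B)"
proof (rule \<pi>_inj[of "A \<otimes> B" E])
  have [simp]: "A \<in> Ob C" using source_in[of f] by simp
  have "\<pi> (A \<otimes> B) E (e B E \<cdot> (f \<boxtimes> \<one> B))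
      = eval (B \<otimes> E) \<cdot> (assoc C (S (B \<otimes> E)) B E \<cdot> ((f \<boxtimes> \<one> B) \<boxtimes> \<one> E))"
    by (subst \<pi>_cmp) simp_all
  also have "\<dots> = eval (B \<otimes> E) \<cdot> ((f \<boxtimes> \<one> (B \<otimes> E)) \<cdot> assoc C A B E)"
    using assoc_natural'[of f "\<one> B" "\<one> E"] by simp
  finally show "\<pi> (A \<otimes> B) E (\<omega> A B E f) = \<pi> (A \<otimes> B) E (e B E \<cdot> (f \<boxtimes> \<one> B))"
    by (simp add: \<pi>_\<omega> \<pi>_eval[of f])
  show "\<omega> A B E f \<in> hom C (A \<otimes> B) (S E)" by (rule \<pi>_\<omega>) simp_all
  show "e B E \<cdot> (f \<boxtimes> \<one> B) \<in> hom C (A \<otimes> B) (S E)" by simp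
qed simp

lemma \<pi>_e_cmp:
  assumes "f \<in> Ar C" "h \<in> Ar C" "target C f = S (B \<otimes> E)" "target C h = B" "B \<in> Ob C" "E \<in> Ob C"
    "X = source C f \<otimes> source C h"
  shows "\<pi> X E (e B E \<cdot> (f \<boxtimes> h))
    = eval (B \<otimes> E) \<cdot> (f \<boxtimes> (h \<boxtimes> \<one> E)) \<cdot> assoc C (source C f) (source C h) E"
  using assms assoc_natural'[of f h "\<one> E"] by (subst \<pi>_cmp) simp_all

text \<open>Under \<open>\<pi>\<close> the naturality and dinaturality of \<open>e\<close> become those of \<open>eval\<close>, moved across an associativity
  isomorphism.\<close>

lemma e_natural:
  assumes [simp]: "A \<in> Ob C" "k \<in> Ar C"
  shows "S_arr k \<cdot> e A (target C k) = e A (source C k) \<cdot> (S_arr (\<one> A \<boxtimes> k) \<boxtimes> \<one> A)"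
proof -
  let ?B = "source C k" and ?B' = "target C k"
  let ?X = "S (A \<otimes> ?B') \<otimes> A"
  have "\<pi> ?X ?B (S_arr k \<cdot> e A ?B')
      = eval (A \<otimes> ?B') \<cdot> (assoc C (S (A \<otimes> ?B')) A ?B' \<cdot> ((\<one> (S (A \<otimes> ?B')) \<boxtimes> \<one> A) \<boxtimes> k))"
    by (simp add: \<pi>_S_arr)
  also have "\<dots> = (eval (target C (\<one> A \<boxtimes> k)) \<cdot> (\<one> (S (target C (\<one> A \<boxtimes> k))) \<boxtimes> (\<one> A \<boxtimes> k)))
      \<cdot> assoc C (S (A \<otimes> ?B')) A ?B"
    using assoc_natural'[of "\<one> (S (A \<otimes> ?B'))" "\<one> A" k] by (simp del: tensor_ident')
  also have "\<dots> = (eval (A \<otimes> ?B) \<cdot> (S_arr (\<one> A \<boxtimes> k) \<boxtimes> \<one> (A \<otimes> ?B))) \<cdot> assoc C (S (A \<otimes> ?B')) A ?B"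
    by (subst eval_dinatural[symmetric]) simp_all
  also have "\<dots> = \<pi> ?X ?B (e A ?B \<cdot> (S_arr (\<one> A \<boxtimes> k) \<boxtimes> \<one> A))"
    by (simp add: \<pi>_e_cmp)
  finally show ?thesis by (rule \<pi>_inj) simp_all
qed

lemma e_dinatural:
  assumes [simp]: "h \<in> Ar C" "B \<in> Ob C"
  shows "e (target C h) B \<cdot> (\<one> (S (target C h \<otimes> B)) \<boxtimes> h)
    = e (source C h) B \<cdot> (S_arr (h \<boxtimes> \<one> B) \<boxtimes> \<one> (source C h))"
proof -
  let ?A = "source C h" and ?A' = "target C h"
  have "\<pi> (S (?A' \<otimes> B) \<otimes> ?A) B (e ?A' B \<cdot> (\<one> (S (?A' \<otimes> B)) \<boxtimes> h))
      = (eval (target C (h \<boxtimes> \<one> B)) \<cdot> (\<one> (S (target C (h \<boxtimes> \<one> B))) \<boxtimes> (h \<boxtimes> \<one> B)))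
        \<cdot> assoc C (S (?A' \<otimes> B)) ?A B"
    by (simp add: \<pi>_e_cmp)
  also have "\<dots> = (eval (?A \<otimes> B) \<cdot> (S_arr (h \<boxtimes> \<one> B) \<boxtimes> \<one> (?A \<otimes> B))) \<cdot> assoc C (S (?A' \<otimes> B)) ?A B"
    by (subst eval_dinatural[symmetric]) simp_all
  also have "\<dots> = \<pi> (S (?A' \<otimes> B) \<otimes> ?A) B (e ?A B \<cdot> (S_arr (h \<boxtimes> \<one> B) \<boxtimes> \<one> ?A))"
    by (simp add: \<pi>_e_cmp)
  finally show ?thesis by (rule \<pi>_inj) simp_all
qed

text \<open>Since \<open>\<pi>\<close> is normalized at the unit object, \<open>e A \<I>\<close> is the evaluation of \<open>A\<close> up to the right unit
  isomorphism; the coherence identity \<open>runit_tensor\<close> shows that the unit isomorphisms match. Thus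
  properties of \<open>e\<close> pass to all evaluations.\<close>

lemma eval_eq_e:
  assumes [simp]: "A \<in> Ob C"
  shows "eval A = e A \<I> \<cdot> (S_arr (runit C A) \<boxtimes> \<one> A)"
proof (rule cancel_right)
  have "eval A \<cdot> runit C (S A \<otimes> A) = (eval A \<cdot> (\<one> (S A) \<boxtimes> runit C A)) \<cdot> assoc C (S A) A \<I>"
    by (simp add: runit_tensor)
  also have "\<dots> = (eval (A \<otimes> \<I>) \<cdot> (S_arr (runit C A) \<boxtimes> \<one> (A \<otimes> \<I>))) \<cdot> assoc C (S A) A \<I>"
    using eval_dinatural[of "runit C A"] by simp
  also have "\<dots> = \<pi> (S A \<otimes> A) \<I> (e A \<I> \<cdot> (S_arr (runit C A) \<boxtimes> \<one> A))"
    by (simp add: \<pi>_e_cmp)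
  also have "\<dots> = (e A \<I> \<cdot> (S_arr (runit C A) \<boxtimes> \<one> A)) \<cdot> runit C (S A \<otimes> A)"
    by (rule \<pi>_unit) simp
  finally show "eval A \<cdot> runit C (S A \<otimes> A) = (e A \<I> \<cdot> (S_arr (runit C A) \<boxtimes> \<one> A)) \<cdot> runit C (S A \<otimes> A)" .
qed simp_all

text \<open>In a strict monoidal category \<open>n_unit\<close> corresponds under \<open>\<pi>\<close> to the identity of \<open>D\<close>.\<close>

lemma n_unit_typed: "n_unit \<in> hom C \<I> (S D)"
  and \<pi>_n_unit: "\<pi> \<I> D n_unit = lunit C D"
proof -
  let ?r = "runit C D"
  \<comment> \<open>\<open>m\<close> is the value of the inverse of \<open>\<omega>\<close> in the definition of \<open>n \<I>\<close>; only its image under \<open>\<pi>\<close> matters.\<close>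
  have "lunit C D \<in> hom C (\<I> \<otimes> D) (S \<I>)" by simp
  then obtain m where m: "m \<in> hom C \<I> (S (D \<otimes> \<I>))" "\<omega> \<I> D \<I> m = lunit C D"
    using bij_betw_imp_surj_on[OF \<omega>_bij[of \<I> D \<I>]] by (metis D_in imageE unit_in)
  have n: "n \<I> = m"
    using the_inv_into_f_f[OF bij_betw_imp_inj_on[OF \<omega>_bij[of \<I> D \<I>]] m(1)] m(2)
    by (simp add: n_def \<rho>_def)
  show t: "n_unit \<in> hom C \<I> (S D)" using m by (simp add: n_unit_def n)
  have "\<pi> \<I> (D \<otimes> \<I>) m \<cdot> assoc C \<I> D \<I> = \<pi> (\<I> \<otimes> D) \<I> (lunit C D)"
    using \<pi>_\<omega>(2)[of m \<I> D \<I>] m by simp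
  also have "\<dots> = (lunit C D \<cdot> (\<one> \<I> \<boxtimes> ?r)) \<cdot> assoc C \<I> D \<I>"
    by (simp add: \<pi>_unit runit_tensor)
  finally have "\<pi> \<I> (D \<otimes> \<I>) m = lunit C D \<cdot> (\<one> \<I> \<boxtimes> ?r)"
    by (rule cancel_right) (use m in simp_all)
  then show "\<pi> \<I> D n_unit = lunit C D"
    using m by (simp add: n_unit_def n \<pi>_S_arr tensor_cmp)
qed

text \<open>The inverse of \<open>\<pi>\<close> expressed by composition: \<open>S_arr g \<cdot> n_unit\<close> is the name \<open>\<I> \<rightarrow> S (A \<otimes> B)\<close> of
  \<open>g = \<pi> A B f\<close>, and applying \<open>e\<close> to the name gives back \<open>f\<close>. The right hand side is made from \<open>g\<close> by
  operations that also exist for coalgebras, which is why transposition preserves coalgebra morphisms.\<close>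

lemma transpose_via_unit:
  assumes f: "f \<in> hom C A (S B)" and [simp]: "B \<in> Ob C"
  shows "f \<cdot> lunit C A = e A B \<cdot> ((S_arr (\<pi> A B f) \<cdot> n_unit) \<boxtimes> \<one> A)"
proof -
  let ?g = "\<pi> A B f"
  have [simp]: "f \<in> Ar C" "source C f = A" "target C f = S B" using f by simp_all
  have [simp]: "A \<in> Ob C" using source_in[of f] by simp
  note [simp] = n_unit_typed[simplified]
  let ?m = "S_arr ?g \<cdot> n_unit"
  have "\<pi> (\<I> \<otimes> A) B (e A B \<cdot> (?m \<boxtimes> \<one> A)) = \<pi> \<I> (A \<otimes> B) ?m \<cdot> assoc C \<I> A B"
    by (simp add: \<pi>_\<omega> flip: \<omega>_e)
  also have "\<pi> \<I> (A \<otimes> B) ?m = lunit C D \<cdot> (\<one> \<I> \<boxtimes> ?g)"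
    by (simp add: \<pi>_S_arr \<pi>_n_unit)
  also have "\<dots> = ?g \<cdot> lunit C (A \<otimes> B)"
    by (rule lunit_natural) simp
  also have "(?g \<cdot> lunit C (A \<otimes> B)) \<cdot> assoc C \<I> A B = ?g \<cdot> (lunit C A \<boxtimes> \<one> B)"
    by (simp add: lunit_tensor)
  also have "\<dots> = \<pi> (\<I> \<otimes> A) B (f \<cdot> lunit C A)"
    by (simp add: \<pi>_cmp)
  finally show ?thesis by (rule \<pi>_inj[OF sym]) simp_all
qed

end

section \<open>Raisers and their adjunction\<close>

context raiser
begin

definition eval' :: "'o \<Rightarrow> 'a" where
  "eval' A = \<pi>' A (S' A) (\<one> (S' A))"

lemma \<pi>'_represents:
  "A \<in> Ob C \<Longrightarrow> represents C (\<lambda>B. A \<otimes> B) (\<lambda>h. \<one> A \<boxtimes> h) D (S' A) (\<pi>' A)"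
  using S'_internal_hom by (simp add: right_internal_hom_iff)

lemma S'_in [simp]: "A \<in> Ob C \<Longrightarrow> S' A \<in> Ob C"
  using represents_in[OF \<pi>'_represents] .

lemma \<pi>'_typed [simp]:
  assumes "f \<in> Ar C" "source C f = B" "target C f = S' A" "A \<in> Ob C"
  shows "\<pi>' A B f \<in> Ar C" "source C (\<pi>' A B f) = A \<otimes> B" "target C (\<pi>' A B f) = D"
  using represents_typed[OF \<pi>'_represents[OF assms(4)], of f B] assms(1-3) by simp_all

lemma \<pi>'_inj:
  assumes "\<pi>' A B f = \<pi>' A B g" and "f \<in> hom C B (S' A)" "g \<in> hom C B (S' A)" "A \<in> Ob C"
  shows "f = g"
  using represents_inj[OF \<pi>'_represents[OF assms(4)] assms(1-3)] .

lemma \<pi>'_cmp: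
  assumes "f \<in> Ar C" "h \<in> Ar C" "source C f = target C h" "target C f = S' A" "A \<in> Ob C"
    "B = source C h"
  shows "\<pi>' A B (f \<cdot> h) = \<pi>' A (target C h) f \<cdot> (\<one> A \<boxtimes> h)"
  using represents_natural[OF \<pi>'_represents[OF assms(5)], of h B "target C h" f] assms by simp

lemma eval'_typed [simp]:
  assumes "A \<in> Ob C"
  shows "eval' A \<in> Ar C" "source C (eval' A) = A \<otimes> S' A" "target C (eval' A) = D"
  using assms by (simp_all add: eval'_def)

lemma \<pi>'_eval':
  assumes "f \<in> Ar C" "source C f = B" "target C f = S' A" "A \<in> Ob C"
  shows "\<pi>' A B f = eval' A \<cdot> (\<one> A \<boxtimes> f)"
  using \<pi>'_cmp[of "\<one> (S' A)" f A B] assms by (simp add: eval'_def)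

lemma \<pi>'_surj:
  assumes "g \<in> hom C (A \<otimes> B) D" "A \<in> Ob C" "B \<in> Ob C"
  obtains f where "f \<in> hom C B (S' A)" "\<pi>' A B f = g"
  using represents_surj[OF \<pi>'_represents[OF assms(2)] assms(3,1)] .

lemma transpose'_\<pi>' [simp]:
  assumes "f \<in> Ar C" "source C f = B" "target C f = S' A" "A \<in> Ob C"
  shows "transpose' A B (\<pi>' A B f) = f"
proof -
  have "B \<in> Ob C" using assms by auto
  from bij_betw_imp_inj_on[OF represents_bij[OF \<pi>'_represents[OF assms(4)] this]]
  show ?thesis unfolding transpose'_def by (rule the_inv_into_f_f) (use assms in simp)
qed

lemma transpose'_typed [simp]:
  assumes "g \<in> Ar C" "source C g = A \<otimes> B" "target C g = D" "A \<in> Ob C" "B \<in> Ob C"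
  shows "transpose' A B g \<in> Ar C" "source C (transpose' A B g) = B"
    "target C (transpose' A B g) = S' A" "\<pi>' A B (transpose' A B g) = g"
proof -
  obtain f where "f \<in> hom C B (S' A)" "\<pi>' A B f = g" using \<pi>'_surj[of g A B] assms by auto
  then show "transpose' A B g \<in> Ar C" "source C (transpose' A B g) = B"
    "target C (transpose' A B g) = S' A" "\<pi>' A B (transpose' A B g) = g"
    using transpose'_\<pi>'[of f B A] assms by auto
qed

lemma S'_arr_eq: "k \<in> Ar C \<Longrightarrow> S'_arr k = transpose' (source C k) (S' (target C k))
    (eval' (target C k) \<cdot> (k \<boxtimes> \<one> (S' (target C k))))"
  by (simp add: S'_arr_def Let_def eval'_def)

lemma S'_arr_typed [simp]:
  assumes "k \<in> Ar C"
  shows "S'_arr k \<in> Ar C" "source C (S'_arr k) = S' (target C k)" "target C (S'_arr k) = S' (source C k)"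
  using assms by (simp_all add: S'_arr_eq)

lemma eval'_dinatural:
  assumes "k \<in> Ar C"
  shows "eval' (source C k) \<cdot> (\<one> (source C k) \<boxtimes> S'_arr k)
    = eval' (target C k) \<cdot> (k \<boxtimes> \<one> (S' (target C k)))"
  using \<pi>'_eval'[of "S'_arr k" "S' (target C k)" "source C k"] assms by (simp add: S'_arr_eq)

text \<open>Naturality of \<open>\<pi>'\<close> in its first argument, the mirror image of \<open>\<pi>_S_arr\<close>.\<close>

lemma \<pi>'_S'_arr:
  assumes "k \<in> Ar C" "f \<in> Ar C" "source C f = B" "target C f = S' (target C k)" "A = source C k"
  shows "\<pi>' A B (S'_arr k \<cdot> f) = \<pi>' (target C k) B f \<cdot> (k \<boxtimes> \<one> B)"
proof -
  have B: "B \<in> Ob C" using assms by auto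
  have "\<pi>' A B (S'_arr k \<cdot> f) = (eval' A \<cdot> (\<one> A \<boxtimes> S'_arr k)) \<cdot> (\<one> A \<boxtimes> f)"
    using assms by (simp add: \<pi>'_eval' tensor_cmp)
  also have "\<dots> = (eval' (target C k) \<cdot> (k \<boxtimes> \<one> (S' (target C k)))) \<cdot> (\<one> A \<boxtimes> f)"
    using eval'_dinatural[OF assms(1)] assms by simp
  also have "\<dots> = \<pi>' (target C k) B f \<cdot> (k \<boxtimes> \<one> B)"
    using assms B by (simp add: \<pi>'_eval' tensor_cmp)
  finally show ?thesis .
qed

lemma S'_arr_ident [simp]:
  assumes [simp]: "A \<in> Ob C"
  shows "S'_arr (\<one> A) = \<one> (S' A)"
proof (rule \<pi>'_inj[of A "S' A"])
  have "\<pi>' A (S' A) (S'_arr (\<one> A) \<cdot> \<one> (S' A)) = \<pi>' A (S' A) (\<one> (S' A))"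
    by (subst \<pi>'_S'_arr) simp_all
  then show "\<pi>' A (S' A) (S'_arr (\<one> A)) = \<pi>' A (S' A) (\<one> (S' A))" by simp
qed simp_all

lemma S'_arr_cmp:
  assumes f: "f \<in> Ar C" and g: "g \<in> Ar C" and fg: "source C f = target C g"
  shows "S'_arr (f \<cdot> g) = S'_arr g \<cdot> S'_arr f"
proof (rule \<pi>'_inj)
  let ?X = "S' (target C f)" and ?B = "source C g"
  have "\<pi>' ?B ?X (S'_arr (f \<cdot> g) \<cdot> \<one> ?X) = eval' (target C f) \<cdot> ((f \<cdot> g) \<boxtimes> \<one> ?X)"
    using assms by (subst \<pi>'_S'_arr) (simp_all add: eval'_def)
  also have "\<dots> = (eval' (target C f) \<cdot> (f \<boxtimes> \<one> ?X)) \<cdot> (g \<boxtimes> \<one> ?X)"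
    using assms by (simp add: tensor_cmp)
  also have "eval' (target C f) \<cdot> (f \<boxtimes> \<one> ?X) = \<pi>' (source C f) ?X (S'_arr f)"
    using \<pi>'_S'_arr[of f "\<one> ?X" ?X "source C f"] f by (simp add: eval'_def)
  also have "\<dots> \<cdot> (g \<boxtimes> \<one> ?X) = \<pi>' ?B ?X (S'_arr g \<cdot> S'_arr f)"
    using \<pi>'_S'_arr[of g "S'_arr f" ?X ?B] assms by simp
  finally show "\<pi>' ?B ?X (S'_arr (f \<cdot> g)) = \<pi>' ?B ?X (S'_arr g \<cdot> S'_arr f)"
    using assms by simp
qed (use assms in simp_all)

lemma S'_functor: "cat_functor C (opposite C) S' S'_arr"
  by (intro cat_functor.intro cat_functor_axioms.intro category_opposite category_axioms)
    (simp_all add: S'_arr_cmp)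

lemma \<alpha>_typed [simp]:
  assumes "A \<in> Ob C"
  shows "\<alpha> A \<in> Ar C" "source C (\<alpha> A) = A" "target C (\<alpha> A) = S (S' A)"
    "\<pi> A (S' A) (\<alpha> A) = eval' A"
  using assms by (simp_all add: \<alpha>_def eval'_def)

lemma \<beta>_typed [simp]:
  assumes "B \<in> Ob C"
  shows "\<beta> B \<in> Ar C" "source C (\<beta> B) = B" "target C (\<beta> B) = S' (S B)"
    "\<pi>' (S B) B (\<beta> B) = eval B"
  using assms by (simp_all add: \<beta>_def eval_def)

text \<open>The transposition \<open>C(B, S' A) \<cong> C(A, S B)\<close> of the adjunction, and below its inverse, written with \<open>\<alpha>\<close> and
  \<open>\<beta>\<close>: under \<open>\<pi>\<close> and \<open>\<pi>'\<close> both sides become the same arrow \<open>A \<otimes> B \<rightarrow> D\<close>.\<close>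

lemma \<pi>_\<alpha>:
  assumes "g \<in> Ar C" "source C g = B" "target C g = S' A" "A \<in> Ob C"
  shows "\<pi> A B (S_arr g \<cdot> \<alpha> A) = \<pi>' A B g"
  using assms by (simp add: \<pi>_S_arr \<pi>'_eval')

lemma \<pi>'_\<beta>:
  assumes "f \<in> Ar C" "source C f = A" "target C f = S B" "B \<in> Ob C"
  shows "\<pi>' A B (S'_arr f \<cdot> \<beta> B) = \<pi> A B f"
  using assms by (simp add: \<pi>'_S'_arr \<pi>_eval)

lemma triangle_S:
  assumes [simp]: "B \<in> Ob C"
  shows "S_arr (\<beta> B) \<cdot> \<alpha> (S B) = \<one> (S B)"
  by (rule \<pi>_inj[of "S B" B]) (simp_all add: \<pi>_\<alpha>, simp add: eval_def)

lemma \<alpha>_natural: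
  assumes [simp]: "f \<in> Ar C"
  shows "S_arr (S'_arr f) \<cdot> \<alpha> (source C f) = \<alpha> (target C f) \<cdot> f"
proof (rule \<pi>_inj[of "source C f" "S' (target C f)"])
  show "\<pi> (source C f) (S' (target C f)) (S_arr (S'_arr f) \<cdot> \<alpha> (source C f))
      = \<pi> (source C f) (S' (target C f)) (\<alpha> (target C f) \<cdot> f)"
    by (subst \<pi>_\<alpha>, simp_all, subst \<pi>_cmp) (simp_all add: \<pi>'_eval' eval'_dinatural)
qed simp_all

lemma \<beta>_natural:
  assumes [simp]: "f \<in> Ar C"
  shows "S'_arr (S_arr f) \<cdot> \<beta> (source C f) = \<beta> (target C f) \<cdot> f"
proof (rule \<pi>'_inj[of "S (target C f)" "source C f"])
  show "\<pi>' (S (target C f)) (source C f) (S'_arr (S_arr f) \<cdot> \<beta> (source C f))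
      = \<pi>' (S (target C f)) (source C f) (\<beta> (target C f) \<cdot> f)"
    by (subst \<pi>'_\<beta>, simp_all, subst \<pi>'_cmp) (simp_all add: \<pi>_eval eval_dinatural)
qed simp_all

section \<open>Internal homs from raisers\<close>

text \<open>The mirror image of \<open>\<omega>\<close>: a bijection \<open>C(B, S' (E \<otimes> A)) \<cong> C(A \<otimes> B, S' E)\<close>, obtained by reading both sides as
  arrows into \<open>D\<close>.\<close>

definition \<omega>' :: "'o \<Rightarrow> 'o \<Rightarrow> 'o \<Rightarrow> 'a \<Rightarrow> 'a" where
  "\<omega>' E A B f = transpose' E (A \<otimes> B) (\<pi>' (E \<otimes> A) B f \<cdot> inv_arrow C (assoc C E A B))"

lemma \<omega>'_bij:
  assumes [simp]: "A \<in> Ob C" "B \<in> Ob C" "E \<in> Ob C"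
  shows "bij_betw (\<omega>' E A B) (hom C B (S' (E \<otimes> A))) (hom C (A \<otimes> B) (S' E))"
  by (rule bij_betw_byWitness[where f' = "\<lambda>g. transpose' (E \<otimes> A) B (\<pi>' E (A \<otimes> B) g \<cdot> assoc C E A B)"])
    (auto simp: \<omega>'_def)

lemma \<omega>'_typed [simp]:
  assumes "f \<in> Ar C" "source C f = B" "target C f = S' (E \<otimes> A)" "A \<in> Ob C" "E \<in> Ob C"
  shows "\<omega>' E A B f \<in> Ar C" "source C (\<omega>' E A B f) = A \<otimes> B" "target C (\<omega>' E A B f) = S' E"
    "\<pi>' E (A \<otimes> B) (\<omega>' E A B f) = \<pi>' (E \<otimes> A) B f \<cdot> inv_arrow C (assoc C E A B)"
  using assms source_in[OF assms(1)] by (simp_all add: \<omega>'_def)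

lemma \<omega>'_cmp:
  assumes [simp]: "f \<in> Ar C" "h \<in> Ar C" "source C f = target C h" "target C f = S' (E \<otimes> A)"
    "A \<in> Ob C" "E \<in> Ob C"
  shows "\<omega>' E A (source C h) (f \<cdot> h) = \<omega>' E A (target C h) f \<cdot> (\<one> A \<boxtimes> h)"
proof (rule \<pi>'_inj[of E "A \<otimes> source C h"])
  let ?B = "source C h" and ?B' = "target C h"
  have nat: "(\<one> (E \<otimes> A) \<boxtimes> h) \<cdot> inv_arrow C (assoc C E A ?B)
      = inv_arrow C (assoc C E A ?B') \<cdot> (\<one> E \<boxtimes> (\<one> A \<boxtimes> h))"
  proof (rule cancel_left, rule cancel_right)
    show "(assoc C E A ?B' \<cdot> (\<one> (E \<otimes> A) \<boxtimes> h) \<cdot> inv_arrow C (assoc C E A ?B)) \<cdot> assoc C E A ?B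
      = (assoc C E A ?B' \<cdot> inv_arrow C (assoc C E A ?B') \<cdot> (\<one> E \<boxtimes> (\<one> A \<boxtimes> h))) \<cdot> assoc C E A ?B"
      using assoc_natural'[of "\<one> E" "\<one> A" h] by simp
  qed simp_all
  have "\<pi>' E (A \<otimes> ?B) (\<omega>' E A ?B (f \<cdot> h))
      = \<pi>' (E \<otimes> A) ?B' f \<cdot> ((\<one> (E \<otimes> A) \<boxtimes> h) \<cdot> inv_arrow C (assoc C E A ?B))"
    by (simp add: \<pi>'_cmp)
  also have "\<dots> = \<pi>' E (A \<otimes> ?B) (\<omega>' E A ?B' f \<cdot> (\<one> A \<boxtimes> h))"
    unfolding nat by (subst \<pi>'_cmp) simp_all
  finally show "\<pi>' E (A \<otimes> ?B) (\<omega>' E A ?B (f \<cdot> h))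
      = \<pi>' E (A \<otimes> ?B) (\<omega>' E A ?B' f \<cdot> (\<one> A \<boxtimes> h))" .
qed simp_all

text \<open>\<open>C(A \<otimes> B, E) \<cong> C(A \<otimes> B, S (S' E)) \<cong> C(A, S (B \<otimes> S' E))\<close>, the first step being invertibility of \<open>\<alpha>\<close>.\<close>

lemma left_internal_hom_S:
  assumes \<alpha>: "invertible C (\<alpha> E)" and [simp]: "B \<in> Ob C" "E \<in> Ob C"
  shows "left_internal_hom C B E (S (B \<otimes> S' E)) (\<lambda>A f. inv_arrow C (\<alpha> E) \<cdot> \<omega> A B (S' E) f)"
  unfolding left_internal_hom_def
proof (intro conjI ballI allI impI)
  fix A assume "A \<in> Ob C"
  then have "bij_betw (\<omega> A B (S' E)) (hom C A (S (B \<otimes> S' E))) (hom C (A \<otimes> B) (S (S' E)))"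
    by (rule \<omega>_bij) simp_all
  from bij_betw_trans[OF this bij_betw_inv_cmp[OF \<alpha>]]
  show "bij_betw (\<lambda>f. inv_arrow C (\<alpha> E) \<cdot> \<omega> A B (S' E) f) (hom C A (S (B \<otimes> S' E)))
      (hom C (A \<otimes> B) E)" by (simp add: comp_def)
next
  fix A A' h f assume "h \<in> hom C A' A" "f \<in> hom C A (S (B \<otimes> S' E))"
  then show "inv_arrow C (\<alpha> E) \<cdot> \<omega> A' B (S' E) (f \<cdot> h)
      = (inv_arrow C (\<alpha> E) \<cdot> \<omega> A B (S' E) f) \<cdot> (h \<boxtimes> \<one> B)"
    using \<alpha> by (simp add: \<omega>_e tensor_cmp)
qed simp_all

text \<open>\<open>C(A \<otimes> B, E) \<cong> C(A \<otimes> B, S' (S E)) \<cong> C(B, S' (S E \<otimes> A))\<close>, the first step being invertibility of \<open>\<beta>\<close>.\<close>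

lemma right_internal_hom_S':
  assumes \<beta>: "invertible C (\<beta> E)" and [simp]: "A \<in> Ob C" "E \<in> Ob C"
  shows "right_internal_hom C A E (S' (S E \<otimes> A)) (\<lambda>B f. inv_arrow C (\<beta> E) \<cdot> \<omega>' (S E) A B f)"
  unfolding right_internal_hom_def
proof (intro conjI ballI allI impI)
  fix B assume "B \<in> Ob C"
  then have "bij_betw (\<omega>' (S E) A B) (hom C B (S' (S E \<otimes> A))) (hom C (A \<otimes> B) (S' (S E)))"
    by (intro \<omega>'_bij) simp_all
  from bij_betw_trans[OF this bij_betw_inv_cmp[OF \<beta>]]
  show "bij_betw (\<lambda>f. inv_arrow C (\<beta> E) \<cdot> \<omega>' (S E) A B f) (hom C B (S' (S E \<otimes> A)))
      (hom C (A \<otimes> B) E)" by (simp add: comp_def)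
next
  fix B B' h f assume h: "h \<in> hom C B' B" and f: "f \<in> hom C B (S' (S E \<otimes> A))"
  then have "\<omega>' (S E) A B' (f \<cdot> h) = \<omega>' (S E) A B f \<cdot> (\<one> A \<boxtimes> h)"
    using \<omega>'_cmp[of f h "S E" A] by simp
  then show "inv_arrow C (\<beta> E) \<cdot> \<omega>' (S E) A B' (f \<cdot> h)
      = (inv_arrow C (\<beta> E) \<cdot> \<omega>' (S E) A B f) \<cdot> (\<one> A \<boxtimes> h)"
    using \<beta> h f by simp
qed simp_all

section \<open>Dualizing objects\<close>

text \<open>For a fully faithful \<open>S\<close> with adjoint \<open>S'\<close> the counit \<open>\<beta>\<close> is invertible: its inverse is the arrow that \<open>S\<close>
  takes to the unit at \<open>S B\<close>. By a triangle identity \<open>\<alpha> (S B)\<close> is then invertible as well, and by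
  naturality so is \<open>\<alpha> A\<close> for every \<open>A\<close> isomorphic to some \<open>S B\<close>, that is, for every \<open>A\<close>.\<close>

lemma equivalence_imp_invertible:
  assumes "equivalence_functor (opposite C) C S S_arr"
  shows "B \<in> Ob C \<Longrightarrow> invertible C (\<beta> B)" and "A \<in> Ob C \<Longrightarrow> invertible C (\<alpha> A)"
proof -
  obtain Ko Ka \<eta> \<theta> where K: "cat_functor C (opposite C) Ko Ka"
    and \<eta>: "nat_iso (opposite C) (opposite C) (\<lambda>X. X) (\<lambda>f. f) (\<lambda>X. Ko (S X)) (\<lambda>f. Ka (S_arr f)) \<eta>"
    and \<theta>: "nat_iso C C (\<lambda>Y. S (Ko Y)) (\<lambda>g. S_arr (Ka g)) (\<lambda>Y. Y) (\<lambda>g. g) \<theta>"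
    using assms unfolding equivalence_functor_def by blast
  interpret K: cat_functor C "opposite C" Ko Ka by (rule K)
  interpret \<eta>: nat_iso "opposite C" "opposite C" "\<lambda>X. X" "\<lambda>f. f" "\<lambda>X. Ko (S X)" "\<lambda>f. Ka (S_arr f)" \<eta>
    by (rule \<eta>)
  interpret \<theta>: nat_iso C C "\<lambda>Y. S (Ko Y)" "\<lambda>g. S_arr (Ka g)" "\<lambda>Y. Y" "\<lambda>g. g" \<theta>
    by (rule \<theta>)
  have \<eta>_typed [simp]: "\<eta> X \<in> Ar C" "source C (\<eta> X) = Ko (S X)" "target C (\<eta> X) = X" "invertible C (\<eta> X)"
    if "X \<in> Ob C" for X
    using \<eta>.component_hom[of X] \<eta>.component_invertible[of X] that by simp_all
  have \<theta>_typed [simp]: "\<theta> Y \<in> Ar C" "source C (\<theta> Y) = S (Ko Y)" "target C (\<theta> Y) = Y" "invertible C (\<theta> Y)"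
    if "Y \<in> Ob C" for Y
    using \<theta>.component_hom[of Y] \<theta>.component_invertible[of Y] that by simp_all
  have [simp]: "Ko Y \<in> Ob C" if "Y \<in> Ob C" for Y using K.Fo_in[OF that] by simp
  have [simp]: "Ka g \<in> Ar C" "source C (Ka g) = Ko (target C g)" "target C (Ka g) = Ko (source C g)"
    if "g \<in> Ar C" for g using K.Fa_typed[OF that] by simp_all
  have faithful: "f = g" if "S_arr f = S_arr g" "f \<in> hom C X Y" "g \<in> hom C X Y" for f g X Y
  proof (rule cancel_right)
    show "f \<cdot> \<eta> X = g \<cdot> \<eta> X"
      using \<eta>.naturality[of f Y X] \<eta>.naturality[of g Y X] that by simp
  qed (use that in auto)
  have K_faithful: "f = g" if "Ka f = Ka g" "f \<in> hom C X Y" "g \<in> hom C X Y" for f g X Y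
  proof (rule cancel_right)
    show "f \<cdot> \<theta> X = g \<cdot> \<theta> X"
      using \<theta>.naturality[of f X Y] \<theta>.naturality[of g X Y] that by simp
  qed (use that in auto)
  \<comment> \<open>The preimage of \<open>g\<close> is \<open>Ka g\<close> transported along \<open>\<eta>\<close>; that it is a preimage needs \<open>Ka\<close> faithful.\<close>
  have full: "\<exists>f \<in> hom C X Y. S_arr f = g" if g: "g \<in> hom C (S Y) (S X)" and [simp]: "X \<in> Ob C" "Y \<in> Ob C" for g X Y
  proof (rule bexI[of _ "\<eta> Y \<cdot> Ka g \<cdot> inv_arrow C (\<eta> X)"])
    let ?f = "\<eta> Y \<cdot> Ka g \<cdot> inv_arrow C (\<eta> X)"
    have g' [simp]: "g \<in> Ar C" "source C g = S Y" "target C g = S X" using g by simp_all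
    show f: "?f \<in> hom C X Y" by simp
    have "\<eta> Y \<cdot> Ka (S_arr ?f) = ?f \<cdot> \<eta> X"
      using \<eta>.naturality[of ?f Y X] f by simp
    also have "\<dots> = \<eta> Y \<cdot> Ka g" by simp
    finally have "Ka (S_arr ?f) = Ka g" by (rule cancel_left) simp_all
    then show "S_arr ?f = g" by (rule K_faithful[of _ _ "S Y" "S X"]) simp_all
  qed
  show \<beta>: "invertible C (\<beta> B)" if [simp]: "B \<in> Ob C" for B
  proof -
    have "\<alpha> (S B) \<in> hom C (S B) (S (S' (S B)))" by simp
    from full[OF this] obtain h where h: "h \<in> hom C (S' (S B)) B" "S_arr h = \<alpha> (S B)" by auto
    have "S_arr (h \<cdot> \<beta> B) = S_arr (\<one> B)"
      using h triangle_S[of B] by (simp add: S_arr_cmp)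
    then have 1: "h \<cdot> \<beta> B = \<one> B" by (rule faithful[of _ _ B B]) (use h in simp_all)
    \<comment> \<open>\<open>\<beta> B \<cdot> h\<close> and the identity have the same adjoint transpose \<open>\<alpha> (S B)\<close>.\<close>
    have "\<pi> (S B) (S' (S B)) (\<alpha> (S B)) = \<pi> (S B) (S' (S B)) (S_arr (\<beta> B \<cdot> h) \<cdot> \<alpha> (S B))"
      using h triangle_S[of B] by (simp add: S_arr_cmp)
    then have "\<pi>' (S B) (S' (S B)) (\<one> (S' (S B))) = \<pi>' (S B) (S' (S B)) (\<beta> B \<cdot> h)"
      using h by (simp add: \<pi>_\<alpha> del: \<alpha>_typed(4)) (simp add: eval'_def)
    then have 2: "\<beta> B \<cdot> h = \<one> (S' (S B))" by (rule \<pi>'_inj[OF sym]) (use h in simp_all)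
    show ?thesis by (rule invertibleI[OF _ h(1) 1 2]) simp
  qed
  show "invertible C (\<alpha> A)" if [simp]: "A \<in> Ob C" for A
  proof -
    \<comment> \<open>\<open>\<theta> A\<close> is an isomorphism from \<open>S (Ko A)\<close> to \<open>A\<close>.\<close>
    let ?B = "Ko A"
    have "invertible C (\<alpha> (S ?B))"
    proof (rule invertibleI)
      have "S_arr (\<beta> ?B) \<cdot> (\<alpha> (S ?B) \<cdot> S_arr (\<beta> ?B)) = S_arr (\<beta> ?B) \<cdot> \<one> (S (S' (S ?B)))"
        using cmp_extend[OF triangle_S, of ?B "S_arr (\<beta> ?B)"] by simp
      then show "\<alpha> (S ?B) \<cdot> S_arr (\<beta> ?B) = \<one> (S (S' (S ?B)))"
        by (rule cancel_left) (simp_all add: S_arr_invertible \<beta>)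
    qed (simp_all add: triangle_S)
    then have "invertible C (\<alpha> (target C (inv_arrow C (\<theta> A))) \<cdot> inv_arrow C (\<theta> A))" by simp
    then have "invertible C (S_arr (S'_arr (inv_arrow C (\<theta> A))) \<cdot> \<alpha> A)"
      using \<alpha>_natural[of "inv_arrow C (\<theta> A)"] by simp
    moreover have i: "invertible C (S_arr (S'_arr (inv_arrow C (\<theta> A))))"
      using cat_functor.preserves_invertible[OF S'_functor, of "inv_arrow C (\<theta> A)"]
      by (simp add: S_arr_invertible)
    ultimately have "invertible C (inv_arrow C (S_arr (S'_arr (inv_arrow C (\<theta> A))))
        \<cdot> (S_arr (S'_arr (inv_arrow C (\<theta> A))) \<cdot> \<alpha> A))"
      by (rule invertible_cmp[OF _ invertible_inv]) (simp_all add: i)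
    then show ?thesis using i by simp
  qed
qed

text \<open>The adjunction is then an adjoint equivalence, with quasi-inverse \<open>S'\<close>. The components required by
  \<open>equivalence_functor\<close> point against \<open>\<alpha>\<close> and \<open>\<beta>\<close>, hence the inverses.\<close>

lemma invertible_imp_dualizing:
  assumes [simp]: "\<And>A. A \<in> Ob C \<Longrightarrow> invertible C (\<alpha> A)" "\<And>B. B \<in> Ob C \<Longrightarrow> invertible C (\<beta> B)"
  shows "dualizing C D S \<pi>"
proof (intro dualizing.intro dualizing_axioms.intro)
  show "left_raiser C D S \<pi>" by (rule left_raiser_axioms)
  interpret S: cat_functor "opposite C" C S S_arr by (rule S_functor)
  interpret S': cat_functor C "opposite C" S' S'_arr by (rule S'_functor)
  have 1: "nat_iso (opposite C) (opposite C) (\<lambda>X. X) (\<lambda>f. f) (\<lambda>X. S' (S X)) (\<lambda>f. S'_arr (S_arr f))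
      (\<lambda>X. inv_arrow C (\<beta> X))"
  proof (unfold_locales, unfold opposite_simps)
    fix f X Y assume f: "f \<in> hom (opposite C) X Y"
    show "f \<cdot> inv_arrow C (\<beta> Y) = inv_arrow C (\<beta> X) \<cdot> S'_arr (S_arr f)"
    proof (rule cancel_right[of _ "\<beta> Y"], rule cancel_left[of "\<beta> X"])
      show "\<beta> X \<cdot> (f \<cdot> inv_arrow C (\<beta> Y)) \<cdot> \<beta> Y
          = \<beta> X \<cdot> (inv_arrow C (\<beta> X) \<cdot> S'_arr (S_arr f)) \<cdot> \<beta> Y"
        using f \<beta>_natural[of f] by auto
    qed (use f in auto)
  qed (auto simp: S_arr_cmp S'_arr_cmp)
  have 2: "nat_iso C C (\<lambda>Y. S (S' Y)) (\<lambda>g. S_arr (S'_arr g)) (\<lambda>Y. Y) (\<lambda>g. g) (\<lambda>Y. inv_arrow C (\<alpha> Y))"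
  proof unfold_locales
    fix f X Y assume f: "f \<in> hom C X Y"
    show "inv_arrow C (\<alpha> Y) \<cdot> S_arr (S'_arr f) = f \<cdot> inv_arrow C (\<alpha> X)"
    proof (rule cancel_right[of _ "\<alpha> X"], rule cancel_left[of "\<alpha> Y"])
      show "\<alpha> Y \<cdot> (inv_arrow C (\<alpha> Y) \<cdot> S_arr (S'_arr f)) \<cdot> \<alpha> X
          = \<alpha> Y \<cdot> (f \<cdot> inv_arrow C (\<alpha> X)) \<cdot> \<alpha> X"
        using f \<alpha>_natural[of f] by auto
    qed (use f in auto)
  qed (auto simp: S_arr_cmp S'_arr_cmp)
  show "equivalence_functor (opposite C) C S S_arr"
    unfolding equivalence_functor_def using 1 2 S_functor S'_functor by blast
qed

end

section \<open>Strict morphisms of raisers\<close>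

text \<open>A strict monoidal functor that commutes with the two families of representations commutes with every
  arrow defined from them by transposition, since transposes are unique.\<close>

locale raiser_morphism = strict_monoidal_functor M N Fo Fa
  + M: raiser M D S \<pi> S' \<pi>' + N: raiser N D2 S2 \<pi>2 S2' \<pi>2'
  for M :: "('o, 'a, 'x) moncat_scheme" and N :: "('p, 'b, 'y) moncat_scheme" and Fo Fa
    D S \<pi> S' \<pi>' D2 S2 \<pi>2 S2' \<pi>2' +
  assumes Fo_S: "X \<in> Ob M \<Longrightarrow> Fo (S X) = S2 (Fo X)"
    and Fo_S': "X \<in> Ob M \<Longrightarrow> Fo (S' X) = S2' (Fo X)"
    and Fa_\<pi>: "\<lbrakk>f \<in> hom M X (S Y); Y \<in> Ob M\<rbrakk> \<Longrightarrow> Fa (\<pi> X Y f) = \<pi>2 (Fo X) (Fo Y) (Fa f)"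
    and Fa_\<pi>': "\<lbrakk>f \<in> hom M Y (S' X); X \<in> Ob M\<rbrakk> \<Longrightarrow> Fa (\<pi>' X Y f) = \<pi>2' (Fo X) (Fo Y) (Fa f)"
begin

lemmas F_simps = Fo_in Fa_typed Fa_ident Fa_cmp strict_tensor strict_tensor_arr strict_assoc
  Fo_S Fo_S' Fa_\<pi> Fa_\<pi>'

lemma Fa_eval: "X \<in> Ob M \<Longrightarrow> Fa (M.eval X) = N.eval (Fo X)"
  unfolding M.eval_def N.eval_def by (simp add: F_simps)

lemma Fa_eval': "X \<in> Ob M \<Longrightarrow> Fa (M.eval' X) = N.eval' (Fo X)"
  unfolding M.eval'_def N.eval'_def by (simp add: F_simps)

lemma Fa_\<alpha>:
  assumes [simp]: "X \<in> Ob M"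
  shows "Fa (M.\<alpha> X) = N.\<alpha> (Fo X)"
proof (rule N.\<pi>_inj[of "Fo X" "Fo (S' X)"])
  have "\<pi>2 (Fo X) (Fo (S' X)) (Fa (M.\<alpha> X)) = Fa (\<pi> X (S' X) (M.\<alpha> X))"
    by (subst Fa_\<pi>) simp_all
  then show "\<pi>2 (Fo X) (Fo (S' X)) (Fa (M.\<alpha> X)) = \<pi>2 (Fo X) (Fo (S' X)) (N.\<alpha> (Fo X))"
    by (simp add: Fa_eval' Fo_S' Fo_in)
qed (simp_all add: F_simps)

lemma Fa_\<beta>:
  assumes [simp]: "X \<in> Ob M"
  shows "Fa (M.\<beta> X) = N.\<beta> (Fo X)"
proof (rule N.\<pi>'_inj[of "Fo (S X)" "Fo X"])
  have "\<pi>2' (Fo (S X)) (Fo X) (Fa (M.\<beta> X)) = Fa (\<pi>' (S X) X (M.\<beta> X))"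
    by (subst Fa_\<pi>') simp_all
  then show "\<pi>2' (Fo (S X)) (Fo X) (Fa (M.\<beta> X)) = \<pi>2' (Fo (S X)) (Fo X) (N.\<beta> (Fo X))"
    by (simp add: Fa_eval Fo_S Fo_in)
qed (simp_all add: F_simps)

lemma Fa_\<omega>:
  assumes [simp]: "f \<in> hom M X (S (Y \<otimes>\<^bsub>M\<^esub> Z))" "X \<in> Ob M" "Y \<in> Ob M" "Z \<in> Ob M"
  shows "Fa (M.\<omega> X Y Z f) = N.\<omega> (Fo X) (Fo Y) (Fo Z) (Fa f)"
proof (rule N.\<pi>_inj[of "Fo X \<otimes>\<^bsub>N\<^esub> Fo Y" "Fo Z"])
  have f [simp]: "f \<in> Ar M" "source M f = X" "target M f = S (Y \<otimes>\<^bsub>M\<^esub> Z)"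
    using assms(1) by simp_all
  note [simp] = M.\<pi>_\<omega>(1)[OF f assms(3,4), simplified]
  have "\<pi>2 (Fo X \<otimes>\<^bsub>N\<^esub> Fo Y) (Fo Z) (Fa (M.\<omega> X Y Z f))
      = Fa (\<pi> (X \<otimes>\<^bsub>M\<^esub> Y) Z (M.\<omega> X Y Z f))"
    by (simp add: Fa_\<pi> strict_tensor)
  also have "\<dots> = Fa (\<pi> X (Y \<otimes>\<^bsub>M\<^esub> Z) f \<cdot>\<^bsub>M\<^esub> assoc M X Y Z)"
    by (subst M.\<pi>_\<omega>(2)) simp_all
  also have "\<dots> = \<pi>2 (Fo X \<otimes>\<^bsub>N\<^esub> Fo Y) (Fo Z) (N.\<omega> (Fo X) (Fo Y) (Fo Z) (Fa f))"
    by (subst N.\<pi>_\<omega>(2)) (simp_all add: F_simps)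
  finally show "\<pi>2 (Fo X \<otimes>\<^bsub>N\<^esub> Fo Y) (Fo Z) (Fa (M.\<omega> X Y Z f))
      = \<pi>2 (Fo X \<otimes>\<^bsub>N\<^esub> Fo Y) (Fo Z) (N.\<omega> (Fo X) (Fo Y) (Fo Z) (Fa f))" .
  show "Fa (M.\<omega> X Y Z f) \<in> hom N (Fo X \<otimes>\<^bsub>N\<^esub> Fo Y) (S2 (Fo Z))"
    by (simp add: F_simps)
  show "N.\<omega> (Fo X) (Fo Y) (Fo Z) (Fa f) \<in> hom N (Fo X \<otimes>\<^bsub>N\<^esub> Fo Y) (S2 (Fo Z))"
    by (rule N.\<pi>_\<omega>(1)) (simp_all add: F_simps)
qed (simp add: Fo_in)

lemma Fa_\<omega>':
  assumes [simp]: "f \<in> hom M Y (S' (Z \<otimes>\<^bsub>M\<^esub> X))" "X \<in> Ob M" "Y \<in> Ob M" "Z \<in> Ob M"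
  shows "Fa (M.\<omega>' Z X Y f) = N.\<omega>' (Fo Z) (Fo X) (Fo Y) (Fa f)"
proof (rule N.\<pi>'_inj[of "Fo Z" "Fo X \<otimes>\<^bsub>N\<^esub> Fo Y"])
  have [simp]: "f \<in> Ar M" "source M f = Y" "target M f = S' (Z \<otimes>\<^bsub>M\<^esub> X)"
    using assms(1) by simp_all
  have "\<pi>2' (Fo Z) (Fo X \<otimes>\<^bsub>N\<^esub> Fo Y) (Fa (M.\<omega>' Z X Y f))
      = Fa (\<pi>' Z (X \<otimes>\<^bsub>M\<^esub> Y) (M.\<omega>' Z X Y f))"
    by (simp add: Fa_\<pi>' strict_tensor del: M.\<omega>'_typed(4))
  also have "\<dots> = \<pi>2' (Fo Z) (Fo X \<otimes>\<^bsub>N\<^esub> Fo Y) (N.\<omega>' (Fo Z) (Fo X) (Fo Y) (Fa f))"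
    by (simp add: F_simps preserves_inv_arrow)
  finally show "\<pi>2' (Fo Z) (Fo X \<otimes>\<^bsub>N\<^esub> Fo Y) (Fa (M.\<omega>' Z X Y f))
      = \<pi>2' (Fo Z) (Fo X \<otimes>\<^bsub>N\<^esub> Fo Y) (N.\<omega>' (Fo Z) (Fo X) (Fo Y) (Fa f))" .
qed (use assms(1) in \<open>simp_all add: F_simps\<close>)

text \<open>The internal homs of \<open>left_internal_hom_S\<close> are preserved with their evaluation \<open>inv (\<alpha> E) \<cdot> e B (S' E)\<close>,
  because the functor commutes with \<open>\<alpha>\<close> and \<open>\<omega>\<close>; by \<open>represents_preserved\<close> this suffices.\<close>

lemma preserves_left_homs:
  assumes \<alpha>: "\<And>X. X \<in> Ob M \<Longrightarrow> invertible M (M.\<alpha> X)"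
  shows "preserves_left_internal_homs M N Fo Fa"
  unfolding preserves_left_internal_homs_def left_internal_hom_iff
proof (intro allI impI)
  fix B E H \<psi>
  assume "B \<in> Ob M \<and> E \<in> Ob M
    \<and> represents M (\<lambda>A. A \<otimes>\<^bsub>M\<^esub> B) (\<lambda>h. h \<boxtimes>\<^bsub>M\<^esub> \<one>\<^bsub>M\<^esub> B) E H \<psi>"
  then have [simp]: "B \<in> Ob M" "E \<in> Ob M"
    and \<psi>: "represents M (\<lambda>A. A \<otimes>\<^bsub>M\<^esub> B) (\<lambda>h. h \<boxtimes>\<^bsub>M\<^esub> \<one>\<^bsub>M\<^esub> B) E H \<psi>"
    by simp_all
  let ?K = "S (B \<otimes>\<^bsub>M\<^esub> S' E)"
  let ?\<chi> = "\<lambda>A f. inv_arrow M (M.\<alpha> E) \<cdot>\<^bsub>M\<^esub> M.\<omega> A B (S' E) f"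
  let ?\<chi>' = "\<lambda>A f. inv_arrow N (N.\<alpha> (Fo E)) \<cdot>\<^bsub>N\<^esub> N.\<omega> A (Fo B) (S2' (Fo E)) f"
  have \<alpha>E [simp]: "invertible M (M.\<alpha> E)" by (rule \<alpha>) simp
  then have \<alpha>'E: "invertible N (N.\<alpha> (Fo E))" using preserves_invertible[of "M.\<alpha> E"] by (simp add: Fa_\<alpha>)
  have \<chi>: "represents M (\<lambda>A. A \<otimes>\<^bsub>M\<^esub> B) (\<lambda>h. h \<boxtimes>\<^bsub>M\<^esub> \<one>\<^bsub>M\<^esub> B) E ?K ?\<chi>"
    using M.left_internal_hom_S[OF \<alpha>E, of B] by (simp add: left_internal_hom_iff)
  have \<chi>': "represents N (\<lambda>A. A \<otimes>\<^bsub>N\<^esub> Fo B) (\<lambda>h. h \<boxtimes>\<^bsub>N\<^esub> \<one>\<^bsub>N\<^esub> (Fo B))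
      (Fo E) (Fo ?K) ?\<chi>'"
    using N.left_internal_hom_S[OF \<alpha>'E, of "Fo B"] by (simp add: left_internal_hom_iff F_simps)
  have "M.\<omega> ?K B (S' E) (\<one>\<^bsub>M\<^esub> ?K) \<in> hom M (?K \<otimes>\<^bsub>M\<^esub> B) (S (S' E))"
    by (rule M.\<pi>_\<omega>(1)) simp_all
  then have "?\<chi>' (Fo ?K) (\<one>\<^bsub>N\<^esub> (Fo ?K)) = Fa (?\<chi> ?K (\<one>\<^bsub>M\<^esub> ?K))"
    by (simp add: F_simps Fa_\<omega> preserves_inv_arrow Fa_\<alpha>)
  from represents_preserved[OF \<chi> \<chi>' this _ _ \<psi>]
  show "\<exists>\<psi>'. (Fo B \<in> Ob N \<and> Fo E \<in> Ob N
      \<and> represents N (\<lambda>A. A \<otimes>\<^bsub>N\<^esub> Fo B) (\<lambda>h. h \<boxtimes>\<^bsub>N\<^esub> \<one>\<^bsub>N\<^esub> (Fo B)) (Fo E) (Fo H) \<psi>')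
      \<and> \<psi>' (Fo H) (\<one>\<^bsub>N\<^esub> (Fo H)) = Fa (\<psi> H (\<one>\<^bsub>M\<^esub> H))"
    by (simp add: F_simps)
qed

lemma preserves_right_homs:
  assumes \<beta>: "\<And>X. X \<in> Ob M \<Longrightarrow> invertible M (M.\<beta> X)"
  shows "preserves_right_internal_homs M N Fo Fa"
  unfolding preserves_right_internal_homs_def right_internal_hom_iff
proof (intro allI impI)
  fix A E H \<psi>
  assume "A \<in> Ob M \<and> E \<in> Ob M
    \<and> represents M (\<lambda>B. A \<otimes>\<^bsub>M\<^esub> B) (\<lambda>h. \<one>\<^bsub>M\<^esub> A \<boxtimes>\<^bsub>M\<^esub> h) E H \<psi>"
  then have [simp]: "A \<in> Ob M" "E \<in> Ob M"
    and \<psi>: "represents M (\<lambda>B. A \<otimes>\<^bsub>M\<^esub> B) (\<lambda>h. \<one>\<^bsub>M\<^esub> A \<boxtimes>\<^bsub>M\<^esub> h) E H \<psi>"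
    by simp_all
  let ?K = "S' (S E \<otimes>\<^bsub>M\<^esub> A)"
  let ?\<chi> = "\<lambda>B f. inv_arrow M (M.\<beta> E) \<cdot>\<^bsub>M\<^esub> M.\<omega>' (S E) A B f"
  let ?\<chi>' = "\<lambda>B f. inv_arrow N (N.\<beta> (Fo E)) \<cdot>\<^bsub>N\<^esub> N.\<omega>' (S2 (Fo E)) (Fo A) B f"
  have \<beta>E [simp]: "invertible M (M.\<beta> E)" by (rule \<beta>) simp
  then have \<beta>'E: "invertible N (N.\<beta> (Fo E))" using preserves_invertible[of "M.\<beta> E"] by (simp add: Fa_\<beta>)
  have \<chi>: "represents M (\<lambda>B. A \<otimes>\<^bsub>M\<^esub> B) (\<lambda>h. \<one>\<^bsub>M\<^esub> A \<boxtimes>\<^bsub>M\<^esub> h) E ?K ?\<chi>"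
    using M.right_internal_hom_S'[OF \<beta>E, of A] by (simp add: right_internal_hom_iff)
  have \<chi>': "represents N (\<lambda>B. Fo A \<otimes>\<^bsub>N\<^esub> B) (\<lambda>h. \<one>\<^bsub>N\<^esub> (Fo A) \<boxtimes>\<^bsub>N\<^esub> h)
      (Fo E) (Fo ?K) ?\<chi>'"
    using N.right_internal_hom_S'[OF \<beta>'E, of "Fo A"] by (simp add: right_internal_hom_iff F_simps)
  have "?\<chi>' (Fo ?K) (\<one>\<^bsub>N\<^esub> (Fo ?K)) = Fa (?\<chi> ?K (\<one>\<^bsub>M\<^esub> ?K))"
    by (simp add: F_simps Fa_\<omega>' preserves_inv_arrow Fa_\<beta>)
  from represents_preserved[OF \<chi> \<chi>' this _ _ \<psi>]
  show "\<exists>\<psi>'. (Fo A \<in> Ob N \<and> Fo E \<in> Ob N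
      \<and> represents N (\<lambda>B. Fo A \<otimes>\<^bsub>N\<^esub> B) (\<lambda>h. \<one>\<^bsub>N\<^esub> (Fo A) \<boxtimes>\<^bsub>N\<^esub> h) (Fo E) (Fo H) \<psi>')
      \<and> \<psi>' (Fo H) (\<one>\<^bsub>N\<^esub> (Fo H)) = Fa (\<psi> H (\<one>\<^bsub>M\<^esub> H))"
    by (simp add: F_simps)
qed

end

section \<open>The monoidal category of coalgebras\<close>

context monoidal_comonad
begin

abbreviation coalgs :: "('o \<times> 'a) set" where
  "coalgs \<equiv> coalgebras C Go Ga \<delta> \<epsilon>"

abbreviation CG where
  "CG \<equiv> coalgebra_category C Go Ga \<delta> \<epsilon> \<phi> \<phi>\<^sub>0"

definition coalgebra_map :: "'o \<times> 'a \<Rightarrow> 'a \<Rightarrow> 'o \<times> 'a \<Rightarrow> bool" where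
  "coalgebra_map X f Y \<longleftrightarrow> X \<in> coalgs \<and> Y \<in> coalgs \<and> f \<in> hom C (fst X) (fst Y)
     \<and> Ga f \<cdot> snd X = snd Y \<cdot> f"

definition tensor_coalg :: "'o \<times> 'a \<Rightarrow> 'o \<times> 'a \<Rightarrow> 'o \<times> 'a" where
  "tensor_coalg X Y = (fst X \<otimes> fst Y, \<phi> (fst X) (fst Y) \<cdot> (snd X \<boxtimes> snd Y))"

definition unit_coalg :: "'o \<times> 'a" where
  "unit_coalg = (\<I>, \<phi>\<^sub>0)"

lemma CG_simps [simp]:
  "Ob CG = coalgs" "t \<in> Ar CG \<longleftrightarrow> coalgebra_map (fst t) (fst (snd t)) (snd (snd t))"
  "source CG t = fst t" "target CG t = snd (snd t)"
  "ident CG X = (X, \<one> (fst X), X)"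
  "cmp CG t s = (fst s, fst (snd t) \<cdot> fst (snd s), snd (snd t))"
  "tensor CG = tensor_coalg"
  "tensor_arr CG t s = (tensor_coalg (fst t) (fst s), fst (snd t) \<boxtimes> fst (snd s), tensor_coalg (snd (snd t)) (snd (snd s)))"
  "tensor_unit CG = unit_coalg"
  "assoc CG X Y Z = (tensor_coalg (tensor_coalg X Y) Z, assoc C (fst X) (fst Y) (fst Z), tensor_coalg X (tensor_coalg Y Z))"
  "lunit CG X = (tensor_coalg unit_coalg X, lunit C (fst X), X)"
  "runit CG X = (tensor_coalg X unit_coalg, runit C (fst X), X)"
  by (auto simp: coalgebra_category_def Let_def tensor_coalg_def unit_coalg_def coalgebra_map_def fun_eq_iff
      split: prod.splits)

lemma tensor_coalg_fst [simp]: "fst (tensor_coalg X Y) = fst X \<otimes> fst Y"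
  and unit_coalg_fst [simp]: "fst unit_coalg = \<I>"
  by (simp_all add: tensor_coalg_def unit_coalg_def)

lemma comonad_typed [simp]:
  "A \<in> Ob C \<Longrightarrow> Go A \<in> Ob C"
  "f \<in> Ar C \<Longrightarrow> Ga f \<in> Ar C"
  "f \<in> Ar C \<Longrightarrow> source C (Ga f) = Go (source C f)"
  "f \<in> Ar C \<Longrightarrow> target C (Ga f) = Go (target C f)"
  "A \<in> Ob C \<Longrightarrow> Ga (\<one> A) = \<one> (Go A)"
  "A \<in> Ob C \<Longrightarrow> \<delta> A \<in> Ar C"
  "A \<in> Ob C \<Longrightarrow> source C (\<delta> A) = Go A"
  "A \<in> Ob C \<Longrightarrow> target C (\<delta> A) = Go (Go A)"
  "A \<in> Ob C \<Longrightarrow> \<epsilon> A \<in> Ar C"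
  "A \<in> Ob C \<Longrightarrow> source C (\<epsilon> A) = Go A"
  "A \<in> Ob C \<Longrightarrow> target C (\<epsilon> A) = A"
  "\<lbrakk>A \<in> Ob C; B \<in> Ob C\<rbrakk> \<Longrightarrow> \<phi> A B \<in> Ar C"
  "\<lbrakk>A \<in> Ob C; B \<in> Ob C\<rbrakk> \<Longrightarrow> source C (\<phi> A B) = Go A \<otimes> Go B"
  "\<lbrakk>A \<in> Ob C; B \<in> Ob C\<rbrakk> \<Longrightarrow> target C (\<phi> A B) = Go (A \<otimes> B)"
  "\<phi>\<^sub>0 \<in> Ar C" "source C \<phi>\<^sub>0 = \<I>" "target C \<phi>\<^sub>0 = Go \<I>"
  using G.Fo_in G.Fa_typed G.Fa_ident \<delta>.component_hom \<epsilon>.component_hom \<phi>_hom \<phi>\<^sub>0_hom by simp_all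

lemma \<delta>_natural: "f \<in> Ar C \<Longrightarrow> \<delta> (target C f) \<cdot> Ga f = Ga (Ga f) \<cdot> \<delta> (source C f)"
  using \<delta>.naturality[of f "source C f" "target C f"] by simp

lemma \<epsilon>_natural: "f \<in> Ar C \<Longrightarrow> \<epsilon> (target C f) \<cdot> Ga f = f \<cdot> \<epsilon> (source C f)"
  using \<epsilon>.naturality[of f "source C f" "target C f"] by simp

lemma \<phi>_natural': "\<lbrakk>f \<in> Ar C; g \<in> Ar C\<rbrakk> \<Longrightarrow>
    \<phi> (target C f) (target C g) \<cdot> (Ga f \<boxtimes> Ga g) = Ga (f \<boxtimes> g) \<cdot> \<phi> (source C f) (source C g)"
  using \<phi>_natural[of f "source C f" "target C f" g "source C g" "target C g"] by simp

lemma coalgebra_typed [simp]: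
  assumes "X \<in> coalgs"
  shows "fst X \<in> Ob C" "snd X \<in> Ar C" "source C (snd X) = fst X" "target C (snd X) = Go (fst X)"
    "\<epsilon> (fst X) \<cdot> snd X = \<one> (fst X)" "\<delta> (fst X) \<cdot> snd X = Ga (snd X) \<cdot> snd X"
  using assms by (auto simp: coalgebras_def)

lemma coalgebraI:
  assumes "A \<in> Ob C" "\<gamma> \<in> hom C A (Go A)" "\<epsilon> A \<cdot> \<gamma> = \<one> A" "\<delta> A \<cdot> \<gamma> = Ga \<gamma> \<cdot> \<gamma>"
  shows "(A, \<gamma>) \<in> coalgs"
  using assms by (simp add: coalgebras_def)

lemma coalgebra_mapI:
  "\<lbrakk>X \<in> coalgs; Y \<in> coalgs; f \<in> Ar C; source C f = fst X; target C f = fst Y;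
    Ga f \<cdot> snd X = snd Y \<cdot> f\<rbrakk> \<Longrightarrow> coalgebra_map X f Y"
  by (simp add: coalgebra_map_def)

lemma coalgebra_mapD:
  assumes "coalgebra_map X f Y"
  shows "X \<in> coalgs" "Y \<in> coalgs" "f \<in> Ar C" "source C f = fst X" "target C f = fst Y"
    "Ga f \<cdot> snd X = snd Y \<cdot> f"
  using assms by (simp_all add: coalgebra_map_def)

lemma coalgebra_map_ident [simp]: "X \<in> coalgs \<Longrightarrow> coalgebra_map X (\<one> (fst X)) X"
  by (simp add: coalgebra_map_def)

lemma coalgebra_map_cmp:
  assumes f: "coalgebra_map X f Y" and g: "coalgebra_map Y g Z"
  shows "coalgebra_map X (g \<cdot> f) Z"
proof (rule coalgebra_mapI)
  note [simp] = coalgebra_mapD(1,3-6)[OF f] coalgebra_mapD[OF g]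
  show "Ga (g \<cdot> f) \<cdot> snd X = snd Z \<cdot> (g \<cdot> f)"
    using cmp_extend[OF coalgebra_mapD(6)[OF g], of f] by (simp add: G.Fa_cmp)
qed (use coalgebra_mapD[OF f] coalgebra_mapD[OF g] in simp_all)

lemma coalgebra_map_inv:
  assumes f: "coalgebra_map X f Y" and i: "invertible C f"
  shows "coalgebra_map Y (inv_arrow C f) X"
proof (rule coalgebra_mapI)
  note [simp] = coalgebra_mapD(1-5)[OF f] i
  have "Ga (inv_arrow C f) \<cdot> snd Y = Ga (inv_arrow C f) \<cdot> (snd Y \<cdot> f) \<cdot> inv_arrow C f" by simp
  also have "snd Y \<cdot> f = Ga f \<cdot> snd X" using coalgebra_mapD(6)[OF f] by simp
  also have "Ga (inv_arrow C f) \<cdot> (Ga f \<cdot> snd X) \<cdot> inv_arrow C f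
      = (Ga (inv_arrow C f) \<cdot> Ga f) \<cdot> snd X \<cdot> inv_arrow C f"
    by simp
  also have "Ga (inv_arrow C f) \<cdot> Ga f = \<one> (Go (fst X))"
    using G.Fa_cmp[of f "inv_arrow C f"] by simp
  finally show "Ga (inv_arrow C f) \<cdot> snd Y = snd X \<cdot> inv_arrow C f" by simp
qed (use coalgebra_mapD[OF f] i in simp_all)

lemma unit_coalgebra [simp]: "unit_coalg \<in> coalgs"
  unfolding unit_coalg_def by (rule coalgebraI) (simp_all add: \<delta>_unit \<epsilon>_unit)

lemma tensor_coalgebra [simp]:
  assumes [simp]: "X \<in> coalgs" "Y \<in> coalgs"
  shows "tensor_coalg X Y \<in> coalgs"
  unfolding tensor_coalg_def
proof (rule coalgebraI)
  let ?A = "fst X" and ?B = "fst Y" and ?a = "snd X" and ?b = "snd Y"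
  have "\<epsilon> (?A \<otimes> ?B) \<cdot> \<phi> ?A ?B \<cdot> (?a \<boxtimes> ?b) = (\<epsilon> ?A \<boxtimes> \<epsilon> ?B) \<cdot> (?a \<boxtimes> ?b)"
    by (rule cmp_extend[OF \<epsilon>_tensor]) simp_all
  then show "\<epsilon> (?A \<otimes> ?B) \<cdot> \<phi> ?A ?B \<cdot> (?a \<boxtimes> ?b) = \<one> (?A \<otimes> ?B)" by (simp add: tensor_cmp)
  have "\<delta> (?A \<otimes> ?B) \<cdot> \<phi> ?A ?B \<cdot> (?a \<boxtimes> ?b)
      = (Ga (\<phi> ?A ?B) \<cdot> \<phi> (Go ?A) (Go ?B) \<cdot> (\<delta> ?A \<boxtimes> \<delta> ?B)) \<cdot> (?a \<boxtimes> ?b)"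
    by (rule cmp_extend[OF \<delta>_tensor]) simp_all
  also have "\<dots> = Ga (\<phi> ?A ?B) \<cdot> (\<phi> (Go ?A) (Go ?B) \<cdot> (Ga ?a \<boxtimes> Ga ?b)) \<cdot> (?a \<boxtimes> ?b)"
    by (simp add: tensor_cmp)
  also have "\<dots> = Ga (\<phi> ?A ?B \<cdot> (?a \<boxtimes> ?b)) \<cdot> \<phi> ?A ?B \<cdot> (?a \<boxtimes> ?b)"
    using \<phi>_natural'[of ?a ?b] by (simp add: G.Fa_cmp)
  finally show "\<delta> (?A \<otimes> ?B) \<cdot> \<phi> ?A ?B \<cdot> (?a \<boxtimes> ?b)
      = Ga (\<phi> ?A ?B \<cdot> (?a \<boxtimes> ?b)) \<cdot> \<phi> ?A ?B \<cdot> (?a \<boxtimes> ?b)" .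
qed simp_all

lemma coalgebra_map_tensor:
  assumes f: "coalgebra_map X f X'" and g: "coalgebra_map Y g Y'"
  shows "coalgebra_map (tensor_coalg X Y) (f \<boxtimes> g) (tensor_coalg X' Y')"
proof (rule coalgebra_mapI)
  note [simp] = coalgebra_mapD(1-5)[OF f] coalgebra_mapD(1-5)[OF g]
  have "Ga (f \<boxtimes> g) \<cdot> snd (tensor_coalg X Y) = (Ga (f \<boxtimes> g) \<cdot> \<phi> (fst X) (fst Y)) \<cdot> (snd X \<boxtimes> snd Y)"
    by (simp add: tensor_coalg_def)
  also have "Ga (f \<boxtimes> g) \<cdot> \<phi> (fst X) (fst Y) = \<phi> (fst X') (fst Y') \<cdot> (Ga f \<boxtimes> Ga g)"
    using \<phi>_natural'[of f g] by simp
  also have "\<dots> \<cdot> (snd X \<boxtimes> snd Y) = \<phi> (fst X') (fst Y') \<cdot> ((Ga f \<cdot> snd X) \<boxtimes> (Ga g \<cdot> snd Y))"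
    by (simp add: tensor_cmp)
  also have "\<dots> = snd (tensor_coalg X' Y') \<cdot> (f \<boxtimes> g)"
    unfolding coalgebra_mapD(6)[OF f] coalgebra_mapD(6)[OF g] by (simp add: tensor_coalg_def tensor_cmp)
  finally show "Ga (f \<boxtimes> g) \<cdot> snd (tensor_coalg X Y) = snd (tensor_coalg X' Y') \<cdot> (f \<boxtimes> g)" .
qed (use coalgebra_mapD[OF f] coalgebra_mapD[OF g] in simp_all)

lemma coalgebra_map_assoc [simp]:
  assumes [simp]: "X \<in> coalgs" "Y \<in> coalgs" "Z \<in> coalgs"
  shows "coalgebra_map (tensor_coalg (tensor_coalg X Y) Z) (assoc C (fst X) (fst Y) (fst Z)) (tensor_coalg X (tensor_coalg Y Z))"
proof (rule coalgebra_mapI)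
  let ?A = "fst X" and ?B = "fst Y" and ?E = "fst Z" and ?a = "snd X" and ?b = "snd Y" and ?c = "snd Z"
  have "Ga (assoc C ?A ?B ?E) \<cdot> snd (tensor_coalg (tensor_coalg X Y) Z)
     = (Ga (assoc C ?A ?B ?E) \<cdot> \<phi> (?A \<otimes> ?B) ?E \<cdot> (\<phi> ?A ?B \<boxtimes> \<one> (Go ?E))) \<cdot> ((?a \<boxtimes> ?b) \<boxtimes> ?c)"
    by (simp add: tensor_coalg_def tensor_cmp)
  also have "\<dots> = (\<phi> ?A (?B \<otimes> ?E) \<cdot> (\<one> (Go ?A) \<boxtimes> \<phi> ?B ?E))
      \<cdot> (assoc C (Go ?A) (Go ?B) (Go ?E) \<cdot> ((?a \<boxtimes> ?b) \<boxtimes> ?c))"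
    by (subst \<phi>_assoc) simp_all
  also have "\<dots> = snd (tensor_coalg X (tensor_coalg Y Z)) \<cdot> assoc C ?A ?B ?E"
    using assoc_natural'[of ?a ?b ?c] by (simp add: tensor_coalg_def tensor_cmp_extend)
  finally show "Ga (assoc C ?A ?B ?E) \<cdot> snd (tensor_coalg (tensor_coalg X Y) Z) = snd (tensor_coalg X (tensor_coalg Y Z)) \<cdot> assoc C ?A ?B ?E" .
qed simp_all

lemma coalgebra_map_lunit [simp]:
  assumes [simp]: "X \<in> coalgs"
  shows "coalgebra_map (tensor_coalg unit_coalg X) (lunit C (fst X)) X"
proof (rule coalgebra_mapI)
  let ?A = "fst X" and ?a = "snd X"
  have "Ga (lunit C ?A) \<cdot> snd (tensor_coalg unit_coalg X) = (Ga (lunit C ?A) \<cdot> \<phi> \<I> ?A \<cdot> (\<phi>\<^sub>0 \<boxtimes> \<one> (Go ?A))) \<cdot> (\<one> \<I> \<boxtimes> ?a)"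
    by (simp add: tensor_coalg_def unit_coalg_def tensor_cmp)
  also have "\<dots> = ?a \<cdot> lunit C ?A"
    using lunit_natural[of ?a ?A "Go ?A"] by (subst \<phi>_lunit) simp_all
  finally show "Ga (lunit C ?A) \<cdot> snd (tensor_coalg unit_coalg X) = ?a \<cdot> lunit C ?A" .
qed simp_all

lemma coalgebra_map_runit [simp]:
  assumes [simp]: "X \<in> coalgs"
  shows "coalgebra_map (tensor_coalg X unit_coalg) (runit C (fst X)) X"
proof (rule coalgebra_mapI)
  let ?A = "fst X" and ?a = "snd X"
  have "Ga (runit C ?A) \<cdot> snd (tensor_coalg X unit_coalg) = (Ga (runit C ?A) \<cdot> \<phi> ?A \<I> \<cdot> (\<one> (Go ?A) \<boxtimes> \<phi>\<^sub>0)) \<cdot> (?a \<boxtimes> \<one> \<I>)"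
    by (simp add: tensor_coalg_def unit_coalg_def tensor_cmp)
  also have "\<dots> = ?a \<cdot> runit C ?A"
    using runit_natural[of ?a ?A "Go ?A"] by (subst \<phi>_runit) simp_all
  finally show "Ga (runit C ?A) \<cdot> snd (tensor_coalg X unit_coalg) = ?a \<cdot> runit C ?A" .
qed simp_all

lemma CG_category: "category CG"
  by (rule category.intro)
    (auto simp: coalgebra_map_cmp coalgebra_mapD)

text \<open>The underlying functor reflects isomorphisms, since the inverse of a coalgebra morphism is again one.\<close>

lemma CG_invertible:
  assumes "coalgebra_map X f Y" "invertible C f"
  shows "invertible CG (X, f, Y)"
  using assms coalgebra_map_inv[OF assms] unfolding invertible_def[of CG]
  by (intro exI[of _ "(Y, inv_arrow C f, X)"]) (simp add: inverse_arrows_def coalgebra_mapD)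

lemma CG_monoidal: "monoidal_category CG"
proof (intro monoidal_category.intro monoidal_category_axioms.intro CG_category)
  have natural: "assoc C A B E \<cdot> ((f \<boxtimes> g) \<boxtimes> h)
      = (f \<boxtimes> (g \<boxtimes> h)) \<cdot> assoc C (source C f) (source C g) (source C h)"
    if "f \<in> Ar C" "g \<in> Ar C" "h \<in> Ar C" "target C f = A" "target C g = B" "target C h = E"
    for f g h A B E
    using assoc_natural' that by blast
  show "assoc CG A' B' E' \<cdot>\<^bsub>CG\<^esub> ((f \<boxtimes>\<^bsub>CG\<^esub> g) \<boxtimes>\<^bsub>CG\<^esub> h)
      = (f \<boxtimes>\<^bsub>CG\<^esub> (g \<boxtimes>\<^bsub>CG\<^esub> h)) \<cdot>\<^bsub>CG\<^esub> assoc CG A B E"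
    if "f \<in> hom CG A A'" "g \<in> hom CG B B'" "h \<in> hom CG E E'" for f g h A A' B B' E E'
    using that by (auto simp: coalgebra_mapD natural)
qed (auto simp: coalgebra_map_tensor coalgebra_mapD CG_invertible tensor_cmp
    lunit_natural runit_natural pentagon triangle)

lemma underlying_strict_monoidal: "strict_monoidal_functor CG C underlying_obj underlying_arr"
  by (intro strict_monoidal_functor.intro strict_monoidal_functor_axioms.intro
      cat_functor.intro cat_functor_axioms.intro CG_monoidal CG_category
      monoidal_category_axioms category_axioms)
    (auto simp: underlying_obj_def underlying_arr_def coalgebra_mapD split: prod.splits)

end

section \<open>Lifting the raiser structure to coalgebras\<close>

context left_star_autonomous_comonad
begin

definition S_coalg :: "'o \<times> 'a \<Rightarrow> 'o \<times> 'a" where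
  "S_coalg X = (S (fst X), Ga (S_arr (snd X)) \<cdot> \<nu> (fst X))"

definition S'_coalg :: "'o \<times> 'a \<Rightarrow> 'o \<times> 'a" where
  "S'_coalg X = (S' (fst X), Ga (S'_arr (snd X)) \<cdot> \<nu>' (fst X))"

lemma S_coalg_fst [simp]: "fst (S_coalg X) = S (fst X)" "fst (S'_coalg X) = S' (fst X)"
  by (simp_all add: S_coalg_def S'_coalg_def)

lemma \<nu>_typed [simp]:
  assumes "A \<in> Ob C"
  shows "\<nu> A \<in> Ar C" "source C (\<nu> A) = S A" "target C (\<nu> A) = Go (S (Go A))"
    "\<nu>' A \<in> Ar C" "source C (\<nu>' A) = S' A" "target C (\<nu>' A) = Go (S' (Go A))"
  using \<nu>.component_hom[of A] \<nu>'.component_hom[of A] assms by simp_all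

lemma \<nu>_natural:
  "f \<in> Ar C \<Longrightarrow> \<nu> (source C f) \<cdot> S_arr f = Ga (S_arr (Ga f)) \<cdot> \<nu> (target C f)"
  "f \<in> Ar C \<Longrightarrow> \<nu>' (source C f) \<cdot> S'_arr f = Ga (S'_arr (Ga f)) \<cdot> \<nu>' (target C f)"
  using \<nu>.naturality[of f "target C f" "source C f"] \<nu>'.naturality[of f "target C f" "source C f"]
  by simp_all

text \<open>Counitality is \<open>\<nu>_counit\<close> transported along the coaction. For coassociativity, \<open>\<nu>_comult\<close> produces
  \<open>S_arr\<close> of \<open>\<delta> A \<cdot> \<gamma> = G \<gamma> \<cdot> \<gamma>\<close>, and naturality of \<open>\<nu>\<close> in \<open>\<gamma>\<close> splits this into two copies of the new
  coaction.\<close>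

lemma S_coalgebra [simp]:
  assumes [simp]: "X \<in> coalgs"
  shows "S_coalg X \<in> coalgs"
  unfolding S_coalg_def
proof (rule coalgebraI)
  let ?A = "fst X" and ?a = "snd X"
  have "\<epsilon> (S ?A) \<cdot> Ga (S_arr ?a) \<cdot> \<nu> ?A = S_arr ?a \<cdot> \<epsilon> (S (Go ?A)) \<cdot> \<nu> ?A"
    using cmp_extend[OF \<epsilon>_natural, of "S_arr ?a" "\<nu> ?A"] by simp
  also have "\<dots> = S_arr (\<epsilon> ?A \<cdot> ?a)" by (subst S_arr_cmp) (simp_all add: \<nu>_counit)
  finally show "\<epsilon> (S ?A) \<cdot> Ga (S_arr ?a) \<cdot> \<nu> ?A = \<one> (S ?A)" by simp
  have "\<delta> (S ?A) \<cdot> Ga (S_arr ?a) \<cdot> \<nu> ?A = Ga (Ga (S_arr ?a)) \<cdot> \<delta> (S (Go ?A)) \<cdot> \<nu> ?A"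
    using cmp_extend[OF \<delta>_natural, of "S_arr ?a" "\<nu> ?A"] by simp
  also have "\<dots> = Ga (Ga (S_arr (\<delta> ?A \<cdot> ?a))) \<cdot> Ga (\<nu> (Go ?A)) \<cdot> \<nu> ?A"
    by (simp add: \<nu>_comult S_arr_cmp G.Fa_cmp del: coalgebra_typed(6))
  also have "\<dots> = Ga (Ga (S_arr ?a) \<cdot> (Ga (S_arr (Ga ?a)) \<cdot> \<nu> (Go ?A))) \<cdot> \<nu> ?A"
    by (simp add: S_arr_cmp G.Fa_cmp)
  also have "Ga (S_arr (Ga ?a)) \<cdot> \<nu> (Go ?A) = \<nu> ?A \<cdot> S_arr ?a"
    using \<nu>_natural(1)[of ?a] by simp
  also have "Ga (Ga (S_arr ?a) \<cdot> (\<nu> ?A \<cdot> S_arr ?a)) \<cdot> \<nu> ?A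
      = Ga (Ga (S_arr ?a) \<cdot> \<nu> ?A) \<cdot> Ga (S_arr ?a) \<cdot> \<nu> ?A"
    by (simp add: G.Fa_cmp)
  finally show "\<delta> (S ?A) \<cdot> Ga (S_arr ?a) \<cdot> \<nu> ?A
      = Ga (Ga (S_arr ?a) \<cdot> \<nu> ?A) \<cdot> Ga (S_arr ?a) \<cdot> \<nu> ?A" .
qed simp_all

lemma S'_coalgebra [simp]:
  assumes [simp]: "X \<in> coalgs"
  shows "S'_coalg X \<in> coalgs"
  unfolding S'_coalg_def
proof (rule coalgebraI)
  let ?A = "fst X" and ?a = "snd X"
  have "\<epsilon> (S' ?A) \<cdot> Ga (S'_arr ?a) \<cdot> \<nu>' ?A = S'_arr ?a \<cdot> \<epsilon> (S' (Go ?A)) \<cdot> \<nu>' ?A"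
    using cmp_extend[OF \<epsilon>_natural, of "S'_arr ?a" "\<nu>' ?A"] by simp
  also have "\<dots> = S'_arr (\<epsilon> ?A \<cdot> ?a)" by (subst S'_arr_cmp) (simp_all add: \<nu>'_counit)
  finally show "\<epsilon> (S' ?A) \<cdot> Ga (S'_arr ?a) \<cdot> \<nu>' ?A = \<one> (S' ?A)" by simp
  have "\<delta> (S' ?A) \<cdot> Ga (S'_arr ?a) \<cdot> \<nu>' ?A = Ga (Ga (S'_arr ?a)) \<cdot> \<delta> (S' (Go ?A)) \<cdot> \<nu>' ?A"
    using cmp_extend[OF \<delta>_natural, of "S'_arr ?a" "\<nu>' ?A"] by simp
  also have "\<dots> = Ga (Ga (S'_arr (\<delta> ?A \<cdot> ?a))) \<cdot> Ga (\<nu>' (Go ?A)) \<cdot> \<nu>' ?A"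
    by (simp add: \<nu>'_comult S'_arr_cmp G.Fa_cmp del: coalgebra_typed(6))
  also have "\<dots> = Ga (Ga (S'_arr ?a) \<cdot> (Ga (S'_arr (Ga ?a)) \<cdot> \<nu>' (Go ?A))) \<cdot> \<nu>' ?A"
    by (simp add: S'_arr_cmp G.Fa_cmp)
  also have "Ga (S'_arr (Ga ?a)) \<cdot> \<nu>' (Go ?A) = \<nu>' ?A \<cdot> S'_arr ?a"
    using \<nu>_natural(2)[of ?a] by simp
  also have "Ga (Ga (S'_arr ?a) \<cdot> (\<nu>' ?A \<cdot> S'_arr ?a)) \<cdot> \<nu>' ?A
      = Ga (Ga (S'_arr ?a) \<cdot> \<nu>' ?A) \<cdot> Ga (S'_arr ?a) \<cdot> \<nu>' ?A"
    by (simp add: G.Fa_cmp)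
  finally show "\<delta> (S' ?A) \<cdot> Ga (S'_arr ?a) \<cdot> \<nu>' ?A
      = Ga (Ga (S'_arr ?a) \<cdot> \<nu>' ?A) \<cdot> Ga (S'_arr ?a) \<cdot> \<nu>' ?A" .
qed simp_all

lemma coalgebra_map_S_arr:
  assumes k: "coalgebra_map X k Y"
  shows "coalgebra_map (S_coalg Y) (S_arr k) (S_coalg X)"
proof (rule coalgebra_mapI)
  note [simp] = coalgebra_mapD(1-5)[OF k]
  have "Ga (S_arr k) \<cdot> snd (S_coalg Y) = Ga (S_arr (snd Y \<cdot> k)) \<cdot> \<nu> (fst Y)"
    by (simp add: S_coalg_def S_arr_cmp G.Fa_cmp)
  also have "\<dots> = Ga (S_arr (snd X)) \<cdot> (Ga (S_arr (Ga k)) \<cdot> \<nu> (fst Y))"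
    unfolding coalgebra_mapD(6)[OF k, symmetric] by (simp add: S_arr_cmp G.Fa_cmp)
  also have "Ga (S_arr (Ga k)) \<cdot> \<nu> (fst Y) = \<nu> (fst X) \<cdot> S_arr k"
    using \<nu>_natural(1)[of k] by simp
  finally show "Ga (S_arr k) \<cdot> snd (S_coalg Y) = snd (S_coalg X) \<cdot> S_arr k" by (simp add: S_coalg_def)
qed (use coalgebra_mapD[OF k] in simp_all)

lemma coalgebra_map_S'_arr:
  assumes k: "coalgebra_map X k Y"
  shows "coalgebra_map (S'_coalg Y) (S'_arr k) (S'_coalg X)"
proof (rule coalgebra_mapI)
  note [simp] = coalgebra_mapD(1-5)[OF k]
  have "Ga (S'_arr k) \<cdot> snd (S'_coalg Y) = Ga (S'_arr (snd Y \<cdot> k)) \<cdot> \<nu>' (fst Y)"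
    by (simp add: S'_coalg_def S'_arr_cmp G.Fa_cmp)
  also have "\<dots> = Ga (S'_arr (snd X)) \<cdot> (Ga (S'_arr (Ga k)) \<cdot> \<nu>' (fst Y))"
    unfolding coalgebra_mapD(6)[OF k, symmetric] by (simp add: S'_arr_cmp G.Fa_cmp)
  also have "Ga (S'_arr (Ga k)) \<cdot> \<nu>' (fst Y) = \<nu>' (fst X) \<cdot> S'_arr k"
    using \<nu>_natural(2)[of k] by simp
  finally show "Ga (S'_arr k) \<cdot> snd (S'_coalg Y) = snd (S'_coalg X) \<cdot> S'_arr k" by (simp add: S'_coalg_def)
qed (use coalgebra_mapD[OF k] in simp_all)

text \<open>Moving the coaction \<open>\<gamma>\<close> of \<open>X\<close> through \<open>\<nu>\<close> and \<open>\<alpha>\<close> by naturality leaves the composite of the axiom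
  \<open>\<nu>_\<alpha>\<close>, followed on the right by \<open>\<gamma>\<close>.\<close>

lemma coalgebra_map_\<alpha>:
  assumes [simp]: "X \<in> coalgs"
  shows "coalgebra_map X (\<alpha> (fst X)) (S_coalg (S'_coalg X))"
proof (rule coalgebra_mapI)
  let ?A = "fst X" and ?a = "snd X"
  have "snd (S_coalg (S'_coalg X)) \<cdot> \<alpha> ?A
      = Ga (S_arr (\<nu>' ?A)) \<cdot> (Ga (S_arr (Ga (S'_arr ?a))) \<cdot> \<nu> (S' ?A)) \<cdot> \<alpha> ?A"
    by (simp add: S_coalg_def S'_coalg_def S_arr_cmp G.Fa_cmp)
  also have "Ga (S_arr (Ga (S'_arr ?a))) \<cdot> \<nu> (S' ?A) = \<nu> (S' (Go ?A)) \<cdot> S_arr (S'_arr ?a)"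
    using \<nu>_natural(1)[of "S'_arr ?a"] by simp
  also have "Ga (S_arr (\<nu>' ?A)) \<cdot> (\<nu> (S' (Go ?A)) \<cdot> S_arr (S'_arr ?a)) \<cdot> \<alpha> ?A
      = Ga (S_arr (\<nu>' ?A)) \<cdot> \<nu> (S' (Go ?A)) \<cdot> (S_arr (S'_arr ?a) \<cdot> \<alpha> ?A)"
    by simp
  also have "S_arr (S'_arr ?a) \<cdot> \<alpha> ?A = \<alpha> (Go ?A) \<cdot> ?a"
    using \<alpha>_natural[of ?a] by simp
  also have "Ga (S_arr (\<nu>' ?A)) \<cdot> \<nu> (S' (Go ?A)) \<cdot> \<alpha> (Go ?A) \<cdot> ?a
      = (Ga (S_arr (\<nu>' ?A)) \<cdot> \<nu> (S' (Go ?A)) \<cdot> \<alpha> (Go ?A)) \<cdot> ?a"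
    by simp
  also have "\<dots> = Ga (\<alpha> ?A) \<cdot> ?a" by (subst \<nu>_\<alpha>) simp_all
  finally show "Ga (\<alpha> ?A) \<cdot> ?a = snd (S_coalg (S'_coalg X)) \<cdot> \<alpha> ?A" by (rule sym)
qed simp_all

lemma coalgebra_map_\<beta>:
  assumes [simp]: "X \<in> coalgs"
  shows "coalgebra_map X (\<beta> (fst X)) (S'_coalg (S_coalg X))"
proof (rule coalgebra_mapI)
  let ?A = "fst X" and ?a = "snd X"
  have "snd (S'_coalg (S_coalg X)) \<cdot> \<beta> ?A
      = Ga (S'_arr (\<nu> ?A)) \<cdot> (Ga (S'_arr (Ga (S_arr ?a))) \<cdot> \<nu>' (S ?A)) \<cdot> \<beta> ?A"
    by (simp add: S_coalg_def S'_coalg_def S'_arr_cmp G.Fa_cmp)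
  also have "Ga (S'_arr (Ga (S_arr ?a))) \<cdot> \<nu>' (S ?A) = \<nu>' (S (Go ?A)) \<cdot> S'_arr (S_arr ?a)"
    using \<nu>_natural(2)[of "S_arr ?a"] by simp
  also have "Ga (S'_arr (\<nu> ?A)) \<cdot> (\<nu>' (S (Go ?A)) \<cdot> S'_arr (S_arr ?a)) \<cdot> \<beta> ?A
      = Ga (S'_arr (\<nu> ?A)) \<cdot> \<nu>' (S (Go ?A)) \<cdot> (S'_arr (S_arr ?a) \<cdot> \<beta> ?A)"
    by simp
  also have "S'_arr (S_arr ?a) \<cdot> \<beta> ?A = \<beta> (Go ?A) \<cdot> ?a"
    using \<beta>_natural[of ?a] by simp
  also have "Ga (S'_arr (\<nu> ?A)) \<cdot> \<nu>' (S (Go ?A)) \<cdot> \<beta> (Go ?A) \<cdot> ?a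
      = (Ga (S'_arr (\<nu> ?A)) \<cdot> \<nu>' (S (Go ?A)) \<cdot> \<beta> (Go ?A)) \<cdot> ?a"
    by simp
  also have "\<dots> = Ga (\<beta> ?A) \<cdot> ?a" by (subst \<nu>_\<beta>) simp_all
  finally show "Ga (\<beta> ?A) \<cdot> ?a = snd (S'_coalg (S_coalg X)) \<cdot> \<beta> ?A" by (rule sym)
qed simp_all

text \<open>The axiom \<open>\<nu>_e\<close> applies after inserting \<open>\<epsilon> \<cdot> \<gamma> = 1\<close> on the factor \<open>X\<close>. It leaves \<open>e\<close> at the cofree
  objects; the coactions of \<open>X\<close> and \<open>Y\<close> lead back to \<open>e\<close> at \<open>X\<close> and \<open>Y\<close>, by
  naturality of \<open>e\<close> in its second argument and dinaturality in its first.\<close>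

lemma coalgebra_map_e:
  assumes [simp]: "X \<in> coalgs" "Y \<in> coalgs"
  shows "coalgebra_map (tensor_coalg (S_coalg (tensor_coalg X Y)) X) (e (fst X) (fst Y)) (S_coalg Y)"
proof (rule coalgebra_mapI)
  let ?A = "fst X" and ?B = "fst Y" and ?a = "snd X" and ?b = "snd Y"
  let ?AB = "?A \<otimes> ?B" and ?GA = "Go ?A" and ?GB = "Go ?B"
  let ?p = "\<phi> ?A ?B"
  \<comment> \<open>Inserting the identity \<open>\<epsilon> \<cdot> \<gamma>\<close> on the factor \<open>X\<close> makes the left hand side of \<open>\<nu>_e\<close> appear.\<close>
  have "snd (S_coalg Y) \<cdot> e ?A ?B
      = Ga (S_arr ?b) \<cdot> (\<nu> ?B \<cdot> e ?A ?B \<cdot> (\<one> (S ?AB) \<boxtimes> \<epsilon> ?A)) \<cdot> (\<one> (S ?AB) \<boxtimes> ?a)"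
    by (simp add: S_coalg_def tensor_cmp)
  also have "\<dots> = Ga (S_arr ?b) \<cdot> (Ga (e ?GA ?GB) \<cdot> Ga (S_arr ?p \<boxtimes> \<one> ?GA)
      \<cdot> \<phi> (S (Go ?AB)) ?GA \<cdot> (\<nu> ?AB \<boxtimes> \<delta> ?A)) \<cdot> (\<one> (S ?AB) \<boxtimes> ?a)"
    by (subst \<nu>_e) simp_all
  \<comment> \<open>\<open>\<delta> \<cdot> \<gamma> = G \<gamma> \<cdot> \<gamma>\<close> frees one copy of the coaction of \<open>X\<close>, which naturality of \<open>\<phi>\<close> moves to the left.\<close>
  also have "\<dots> = Ga (S_arr ?b \<cdot> e ?GA ?GB) \<cdot> Ga (S_arr ?p \<boxtimes> \<one> ?GA)
      \<cdot> (\<phi> (S (Go ?AB)) ?GA \<cdot> (Ga (\<one> (S (Go ?AB))) \<boxtimes> Ga ?a)) \<cdot> (\<nu> ?AB \<boxtimes> ?a)"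
    by (simp add: G.Fa_cmp tensor_cmp)
  also have "\<phi> (S (Go ?AB)) ?GA \<cdot> (Ga (\<one> (S (Go ?AB))) \<boxtimes> Ga ?a)
      = Ga (\<one> (S (Go ?AB)) \<boxtimes> ?a) \<cdot> \<phi> (S (Go ?AB)) ?A"
    using \<phi>_natural'[of "\<one> (S (Go ?AB))" ?a] by (simp del: comonad_typed(5))
  also have "S_arr ?b \<cdot> e ?GA ?GB = e ?GA ?B \<cdot> (S_arr (\<one> ?GA \<boxtimes> ?b) \<boxtimes> \<one> ?GA)"
    using e_natural[of ?GA ?b] by simp
  also have "Ga (e ?GA ?B \<cdot> (S_arr (\<one> ?GA \<boxtimes> ?b) \<boxtimes> \<one> ?GA)) \<cdot> Ga (S_arr ?p \<boxtimes> \<one> ?GA)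
      \<cdot> (Ga (\<one> (S (Go ?AB)) \<boxtimes> ?a) \<cdot> \<phi> (S (Go ?AB)) ?A) \<cdot> (\<nu> ?AB \<boxtimes> ?a)
      = Ga ((e ?GA ?B \<cdot> (S_arr (\<one> ?GA \<boxtimes> ?b) \<boxtimes> \<one> ?GA)) \<cdot> (S_arr ?p \<boxtimes> \<one> ?GA)
          \<cdot> (\<one> (S (Go ?AB)) \<boxtimes> ?a)) \<cdot> \<phi> (S (Go ?AB)) ?A \<cdot> (\<nu> ?AB \<boxtimes> ?a)"
    by (simp add: G.Fa_cmp)
  also have "(e ?GA ?B \<cdot> (S_arr (\<one> ?GA \<boxtimes> ?b) \<boxtimes> \<one> ?GA)) \<cdot> (S_arr ?p \<boxtimes> \<one> ?GA)
        \<cdot> (\<one> (S (Go ?AB)) \<boxtimes> ?a)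
      = (e ?GA ?B \<cdot> (\<one> (S (?GA \<otimes> ?B)) \<boxtimes> ?a)) \<cdot> ((S_arr (\<one> ?GA \<boxtimes> ?b) \<cdot> S_arr ?p) \<boxtimes> \<one> ?A)"
    by (simp add: tensor_cmp)
  \<comment> \<open>Dinaturality moves that copy into \<open>S_arr\<close>, completing the coaction of the tensor product there.\<close>
  also have "e ?GA ?B \<cdot> (\<one> (S (?GA \<otimes> ?B)) \<boxtimes> ?a) = e ?A ?B \<cdot> (S_arr (?a \<boxtimes> \<one> ?B) \<boxtimes> \<one> ?A)"
    using e_dinatural[of ?a ?B] by simp
  also have "(e ?A ?B \<cdot> (S_arr (?a \<boxtimes> \<one> ?B) \<boxtimes> \<one> ?A))
        \<cdot> ((S_arr (\<one> ?GA \<boxtimes> ?b) \<cdot> S_arr ?p) \<boxtimes> \<one> ?A)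
      = e ?A ?B \<cdot> ((S_arr (?a \<boxtimes> \<one> ?B) \<cdot> S_arr (\<one> ?GA \<boxtimes> ?b) \<cdot> S_arr ?p) \<boxtimes> \<one> ?A)"
    by (simp add: tensor_cmp)
  also have "S_arr (?a \<boxtimes> \<one> ?B) \<cdot> S_arr (\<one> ?GA \<boxtimes> ?b) \<cdot> S_arr ?p
      = S_arr (?p \<cdot> (\<one> ?GA \<boxtimes> ?b) \<cdot> (?a \<boxtimes> \<one> ?B))"
    by (simp add: S_arr_cmp)
  also have "?p \<cdot> (\<one> ?GA \<boxtimes> ?b) \<cdot> (?a \<boxtimes> \<one> ?B) = snd (tensor_coalg X Y)"
    by (simp add: tensor_cmp tensor_coalg_def)
  also have "Ga (e ?A ?B \<cdot> (S_arr (snd (tensor_coalg X Y)) \<boxtimes> \<one> ?A)) \<cdot> \<phi> (S (Go ?AB)) ?A \<cdot> (\<nu> ?AB \<boxtimes> ?a)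
      = Ga (e ?A ?B) \<cdot> (Ga (S_arr (snd (tensor_coalg X Y)) \<boxtimes> \<one> ?A) \<cdot> \<phi> (S (Go ?AB)) ?A) \<cdot> (\<nu> ?AB \<boxtimes> ?a)"
    using coalgebra_typed[OF tensor_coalgebra[OF assms]] by (simp add: G.Fa_cmp)
  also have "Ga (S_arr (snd (tensor_coalg X Y)) \<boxtimes> \<one> ?A) \<cdot> \<phi> (S (Go ?AB)) ?A
      = \<phi> (S ?AB) ?A \<cdot> (Ga (S_arr (snd (tensor_coalg X Y))) \<boxtimes> \<one> ?GA)"
    using \<phi>_natural'[of "S_arr (snd (tensor_coalg X Y))" "\<one> ?A"] coalgebra_typed[OF tensor_coalgebra[OF assms]] by simp
  also have "Ga (e ?A ?B) \<cdot> (\<phi> (S ?AB) ?A \<cdot> (Ga (S_arr (snd (tensor_coalg X Y))) \<boxtimes> \<one> ?GA)) \<cdot> (\<nu> ?AB \<boxtimes> ?a)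
      = Ga (e ?A ?B) \<cdot> \<phi> (S ?AB) ?A \<cdot> ((Ga (S_arr (snd (tensor_coalg X Y))) \<cdot> \<nu> ?AB) \<boxtimes> ?a)"
    using coalgebra_typed[OF tensor_coalgebra[OF assms]] by (simp add: tensor_cmp)
  also have "\<phi> (S ?AB) ?A \<cdot> ((Ga (S_arr (snd (tensor_coalg X Y))) \<cdot> \<nu> ?AB) \<boxtimes> ?a) = snd (tensor_coalg (S_coalg (tensor_coalg X Y)) X)"
    unfolding tensor_coalg_def[of "S_coalg (tensor_coalg X Y)" X] by (simp add: S_coalg_def)
  finally show "Ga (e ?A ?B) \<cdot> snd (tensor_coalg (S_coalg (tensor_coalg X Y)) X) = snd (S_coalg Y) \<cdot> e ?A ?B" by (rule sym)
qed simp_all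

text \<open>The axiom \<open>\<nu>_n\<close>, its right hand side being the coaction of \<open>S (S \<I>)\<close> with \<open>S_arr\<close> and \<open>Ga\<close> distributed over
  the composites.\<close>

lemma coalgebra_map_n_unit: "coalgebra_map unit_coalg n_unit (S_coalg (S_coalg unit_coalg))"
proof (rule coalgebra_mapI)
  show "Ga n_unit \<cdot> snd unit_coalg = snd (S_coalg (S_coalg unit_coalg)) \<cdot> n_unit"
    using \<nu>_n n_unit_typed by (simp add: unit_coalg_def S_coalg_def S_arr_cmp G.Fa_cmp)
qed (use n_unit_typed in simp_all)

lemma coalgebra_map_eval:
  assumes [simp]: "X \<in> coalgs"
  shows "coalgebra_map (tensor_coalg (S_coalg X) X) (eval (fst X)) (S_coalg unit_coalg)"
  using coalgebra_map_cmp[OF coalgebra_map_tensor[OF coalgebra_map_S_arr[OF coalgebra_map_runit[OF assms]]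
      coalgebra_map_ident[OF assms]] coalgebra_map_e[OF assms unit_coalgebra]]
  by (simp add: eval_eq_e)

lemma coalgebra_map_\<pi>:
  assumes f: "coalgebra_map X f (S_coalg Y)" and Y [simp]: "Y \<in> coalgs"
  shows "coalgebra_map (tensor_coalg X Y) (\<pi> (fst X) (fst Y) f) (S_coalg unit_coalg)"
  using coalgebra_map_cmp[OF coalgebra_map_tensor[OF f coalgebra_map_ident[OF Y]] coalgebra_map_eval[OF Y]]
    coalgebra_mapD[OF f] by (simp add: \<pi>_eval)

text \<open>Transposition is expressed in \<open>transpose_via_unit\<close> by coalgebra morphisms only.\<close>

lemma coalgebra_map_transpose:
  assumes g: "coalgebra_map (tensor_coalg X Y) g (S_coalg unit_coalg)" and X [simp]: "X \<in> coalgs" and Y [simp]: "Y \<in> coalgs"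
  shows "coalgebra_map X (transpose (fst X) (fst Y) g) (S_coalg Y)"
proof -
  let ?f = "transpose (fst X) (fst Y) g"
  have g' [simp]: "g \<in> Ar C" "source C g = fst X \<otimes> fst Y" "target C g = D"
    using coalgebra_mapD[OF g] by simp_all
  have "?f \<cdot> lunit C (fst X) = e (fst X) (fst Y) \<cdot> ((S_arr g \<cdot> n_unit) \<boxtimes> \<one> (fst X))"
    using transpose_via_unit[of ?f "fst X" "fst Y"] by simp
  then have "?f = (e (fst X) (fst Y) \<cdot> ((S_arr g \<cdot> n_unit) \<boxtimes> \<one> (fst X))) \<cdot> inv_arrow C (lunit C (fst X))"
    using n_unit_typed cmp_assoc'[of "inv_arrow C (lunit C (fst X))" "lunit C (fst X)" ?f] by simp
  moreover have "coalgebra_map X ((e (fst X) (fst Y) \<cdot> ((S_arr g \<cdot> n_unit) \<boxtimes> \<one> (fst X)))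
      \<cdot> inv_arrow C (lunit C (fst X))) (S_coalg Y)"
    by (rule coalgebra_map_cmp[OF coalgebra_map_inv[OF coalgebra_map_lunit[OF X]]
          coalgebra_map_cmp[OF coalgebra_map_tensor[OF coalgebra_map_cmp[OF coalgebra_map_n_unit
            coalgebra_map_S_arr[OF g]] coalgebra_map_ident[OF X]] coalgebra_map_e[OF X Y]]]) simp
  ultimately show ?thesis by simp
qed

text \<open>By \<open>\<pi>_\<alpha>\<close>, \<open>\<pi>'\<close> is the adjunction followed by \<open>\<pi>\<close>, both of which respect coalgebra morphisms; by
  \<open>\<pi>'_\<beta>\<close> the same holds for the inverse.\<close>

lemma coalgebra_map_\<pi>':
  assumes f: "coalgebra_map Y f (S'_coalg X)" and X [simp]: "X \<in> coalgs"
  shows "coalgebra_map (tensor_coalg X Y) (\<pi>' (fst X) (fst Y) f) (S_coalg unit_coalg)"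
proof -
  have "coalgebra_map X (S_arr f \<cdot> \<alpha> (fst X)) (S_coalg Y)"
    by (rule coalgebra_map_cmp[OF coalgebra_map_\<alpha>[OF X] coalgebra_map_S_arr[OF f]])
  from coalgebra_map_\<pi>[OF this coalgebra_mapD(1)[OF f]] show ?thesis
    using coalgebra_mapD[OF f] by (simp add: \<pi>_\<alpha>)
qed

lemma coalgebra_map_transpose':
  assumes g: "coalgebra_map (tensor_coalg X Y) g (S_coalg unit_coalg)" and X [simp]: "X \<in> coalgs" and Y [simp]: "Y \<in> coalgs"
  shows "coalgebra_map Y (transpose' (fst X) (fst Y) g) (S'_coalg X)"
proof -
  let ?f = "transpose (fst X) (fst Y) g"
  have [simp]: "g \<in> Ar C" "source C g = fst X \<otimes> fst Y" "target C g = D"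
    using coalgebra_mapD[OF g] by simp_all
  have "transpose' (fst X) (fst Y) (\<pi>' (fst X) (fst Y) (S'_arr ?f \<cdot> \<beta> (fst Y))) = S'_arr ?f \<cdot> \<beta> (fst Y)"
    by (rule transpose'_\<pi>') simp_all
  then have "transpose' (fst X) (fst Y) g = S'_arr ?f \<cdot> \<beta> (fst Y)"
    by (subst (asm) \<pi>'_\<beta>) simp_all
  then show ?thesis
    using coalgebra_map_cmp[OF coalgebra_map_\<beta>[OF Y] coalgebra_map_S'_arr[OF coalgebra_map_transpose[OF g X Y]]]
    by simp
qed

definition \<pi>_coalg :: "'o \<times> 'a \<Rightarrow> 'o \<times> 'a \<Rightarrow> ('o \<times> 'a) \<times> 'a \<times> ('o \<times> 'a)
    \<Rightarrow> ('o \<times> 'a) \<times> 'a \<times> ('o \<times> 'a)" where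
  "\<pi>_coalg X Y t = (tensor_coalg X Y, \<pi> (fst X) (fst Y) (fst (snd t)), S_coalg unit_coalg)"

definition \<pi>'_coalg :: "'o \<times> 'a \<Rightarrow> 'o \<times> 'a \<Rightarrow> ('o \<times> 'a) \<times> 'a \<times> ('o \<times> 'a)
    \<Rightarrow> ('o \<times> 'a) \<times> 'a \<times> ('o \<times> 'a)" where
  "\<pi>'_coalg X Y t = (tensor_coalg X Y, \<pi>' (fst X) (fst Y) (fst (snd t)), S_coalg unit_coalg)"

lemma CG_raiser: "raiser CG (S_coalg unit_coalg) S_coalg \<pi>_coalg S'_coalg \<pi>'_coalg"
proof (intro raiser.intro left_raiser.intro raiser_axioms.intro left_raiser_axioms.intro CG_monoidal)
  show "left_internal_hom CG Y (S_coalg unit_coalg) (S_coalg Y) (\<lambda>X. \<pi>_coalg X Y)" if "Y \<in> Ob CG" for Y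
    unfolding left_internal_hom_def
  proof (intro conjI ballI allI impI)
    fix X assume "X \<in> Ob CG"
    then have X [simp]: "X \<in> coalgs" and Y [simp]: "Y \<in> coalgs" using that by simp_all
    show "bij_betw (\<pi>_coalg X Y) (hom CG X (S_coalg Y)) (hom CG (X \<otimes>\<^bsub>CG\<^esub> Y) (S_coalg unit_coalg))"
      by (rule bij_betw_byWitness[where f' = "\<lambda>t. (X, transpose (fst X) (fst Y) (fst (snd t)), S_coalg Y)"])
        (use coalgebra_map_\<pi>[OF _ Y, of X] coalgebra_map_transpose[OF _ X Y]
          in \<open>auto simp: \<pi>_coalg_def coalgebra_mapD\<close>)
  next
    fix X X' h f assume h: "h \<in> hom CG X' X" and f: "f \<in> hom CG X (S_coalg Y)"
    then show "\<pi>_coalg X' Y (f \<cdot>\<^bsub>CG\<^esub> h) = \<pi>_coalg X Y f \<cdot>\<^bsub>CG\<^esub> (h \<boxtimes>\<^bsub>CG\<^esub> \<one>\<^bsub>CG\<^esub> Y)"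
      using that by (auto simp: \<pi>_coalg_def coalgebra_mapD \<pi>_cmp)
  qed (use that in simp_all)
  show "right_internal_hom CG X (S_coalg unit_coalg) (S'_coalg X) (\<pi>'_coalg X)" if "X \<in> Ob CG" for X
    unfolding right_internal_hom_def
  proof (intro conjI ballI allI impI)
    fix Y assume "Y \<in> Ob CG"
    then have X [simp]: "X \<in> coalgs" and Y [simp]: "Y \<in> coalgs" using that by simp_all
    show "bij_betw (\<pi>'_coalg X Y) (hom CG Y (S'_coalg X)) (hom CG (X \<otimes>\<^bsub>CG\<^esub> Y) (S_coalg unit_coalg))"
      by (rule bij_betw_byWitness[where f' = "\<lambda>t. (Y, transpose' (fst X) (fst Y) (fst (snd t)), S'_coalg X)"])
        (use coalgebra_map_\<pi>'[OF _ X, of Y] coalgebra_map_transpose'[OF _ X Y]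
          in \<open>auto simp: \<pi>'_coalg_def coalgebra_mapD\<close>)
  next
    fix Y Y' h f assume h: "h \<in> hom CG Y' Y" and f: "f \<in> hom CG Y (S'_coalg X)"
    then show "\<pi>'_coalg X Y' (f \<cdot>\<^bsub>CG\<^esub> h) = \<pi>'_coalg X Y f \<cdot>\<^bsub>CG\<^esub> (\<one>\<^bsub>CG\<^esub> X \<boxtimes>\<^bsub>CG\<^esub> h)"
      using that by (auto simp: \<pi>'_coalg_def coalgebra_mapD \<pi>'_cmp)
  qed (use that in simp_all)
  show "\<pi>_coalg X \<I>\<^bsub>CG\<^esub> f = f \<cdot>\<^bsub>CG\<^esub> runit CG X" if "f \<in> hom CG X (S_coalg unit_coalg)" for f X
    using that \<pi>_unit[of "fst (snd f)" "fst X"] by (auto simp: \<pi>_coalg_def coalgebra_mapD)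
qed simp_all

lemma underlying_raiser_morphism:
  "raiser_morphism CG C underlying_obj underlying_arr (S_coalg unit_coalg) S_coalg \<pi>_coalg S'_coalg \<pi>'_coalg D S \<pi> S' \<pi>'"
  by (intro raiser_morphism.intro raiser_morphism_axioms.intro CG_raiser raiser_axioms
      underlying_strict_monoidal)
    (auto simp: underlying_obj_def underlying_arr_def \<pi>_coalg_def \<pi>'_coalg_def split: prod.splits)

text \<open>The underlying arrow of the unit at a coalgebra is \<open>\<alpha>\<close>, so \<open>CG_invertible\<close> applies; likewise for the
  counit.\<close>

lemma CG_\<alpha>_invertible:
  assumes X: "X \<in> coalgs" and \<alpha>: "invertible C (\<alpha> (fst X))"
  shows "invertible CG (raiser.\<alpha> CG S_coalg \<pi>_coalg S'_coalg \<pi>'_coalg X)"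
proof -
  interpret U: raiser_morphism CG C underlying_obj underlying_arr "S_coalg unit_coalg" S_coalg \<pi>_coalg S'_coalg \<pi>'_coalg D S \<pi> S' \<pi>'
    by (rule underlying_raiser_morphism)
  obtain P f Q where t: "U.M.\<alpha> X = (P, f, Q)" by (cases "U.M.\<alpha> X")
  have "f = \<alpha> (fst X)" using U.Fa_\<alpha>[of X] X t by (simp add: underlying_arr_def underlying_obj_def)
  moreover have "coalgebra_map P f Q" using U.M.\<alpha>_typed(1)[of X] X t by simp
  ultimately show ?thesis using CG_invertible \<alpha> t by simp
qed

lemma CG_\<beta>_invertible:
  assumes X: "X \<in> coalgs" and \<beta>: "invertible C (\<beta> (fst X))"
  shows "invertible CG (raiser.\<beta> CG S_coalg \<pi>_coalg S'_coalg \<pi>'_coalg X)"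
proof -
  interpret U: raiser_morphism CG C underlying_obj underlying_arr "S_coalg unit_coalg" S_coalg \<pi>_coalg S'_coalg \<pi>'_coalg D S \<pi> S' \<pi>'
    by (rule underlying_raiser_morphism)
  obtain P f Q where t: "U.M.\<beta> X = (P, f, Q)" by (cases "U.M.\<beta> X")
  have "f = \<beta> (fst X)" using U.Fa_\<beta>[of X] X t by (simp add: underlying_arr_def underlying_obj_def)
  moreover have "coalgebra_map P f Q" using U.M.\<beta>_typed(1)[of X] X t by simp
  ultimately show ?thesis using CG_invertible \<beta> t by simp
qed

end

theorem corollary3p3:
  fixes C :: "('o, 'a, 'x) moncat_scheme"
    and D :: 'o and S S' Go :: "'o \<Rightarrow> 'o" and \<pi> \<pi>' :: "'o \<Rightarrow> 'o \<Rightarrow> 'a \<Rightarrow> 'a"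
    and Ga :: "'a \<Rightarrow> 'a" and \<delta> \<epsilon> \<nu> \<nu>' :: "'o \<Rightarrow> 'a"
    and \<phi> :: "'o \<Rightarrow> 'o \<Rightarrow> 'a" and \<phi>\<^sub>0 :: 'a
  assumes "left_star_autonomous_comonad C D S \<pi> S' \<pi>' Go Ga \<delta> \<epsilon> \<phi> \<phi>\<^sub>0 \<nu> \<nu>'"
  shows "let CG = coalgebra_category C Go Ga \<delta> \<epsilon> \<phi> \<phi>\<^sub>0 in
         (left_dualizing C D S \<pi> S' \<pi>' \<longrightarrow>
            left_star_autonomous CG
            \<and> strict_monoidal_functor CG C underlying_obj underlying_arr
            \<and> preserves_left_internal_homs CG C underlying_obj underlying_arr)
         \<and> (dualizing C D S \<pi> \<longrightarrow>
            star_autonomous CG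
            \<and> preserves_left_internal_homs CG C underlying_obj underlying_arr
            \<and> preserves_right_internal_homs CG C underlying_obj underlying_arr)"
  unfolding Let_def
proof (intro conjI[of "_ \<longrightarrow> _"] impI)
  interpret left_star_autonomous_comonad C D S \<pi> S' \<pi>' Go Ga \<delta> \<epsilon> \<phi> \<phi>\<^sub>0 \<nu> \<nu>'
    by (rule assms)
  interpret U: raiser_morphism CG C underlying_obj underlying_arr "S_coalg unit_coalg" S_coalg \<pi>_coalg S'_coalg \<pi>'_coalg D S \<pi> S' \<pi>'
    by (rule underlying_raiser_morphism)
  show "left_star_autonomous CG
      \<and> strict_monoidal_functor CG C underlying_obj underlying_arr
      \<and> preserves_left_internal_homs CG C underlying_obj underlying_arr"
    if "left_dualizing C D S \<pi> S' \<pi>'"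
  proof -
    have \<alpha>: "invertible CG (U.M.\<alpha> X)" if "X \<in> Ob CG" for X
      using left_dualizing.\<alpha>_invertible[OF \<open>left_dualizing C D S \<pi> S' \<pi>'\<close>] that
      by (intro CG_\<alpha>_invertible) simp_all
    then have "left_dualizing CG (S_coalg unit_coalg) S_coalg \<pi>_coalg S'_coalg \<pi>'_coalg"
      by (intro left_dualizing.intro left_dualizing_axioms.intro CG_raiser)
    then show ?thesis
      unfolding left_star_autonomous_def
      using underlying_strict_monoidal U.preserves_left_homs[OF \<alpha>] by blast
  qed
  show "star_autonomous CG
      \<and> preserves_left_internal_homs CG C underlying_obj underlying_arr
      \<and> preserves_right_internal_homs CG C underlying_obj underlying_arr"
    if "dualizing C D S \<pi>"
  proof -
    note equiv = dualizing.S_equivalence[OF that]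
    have \<alpha>: "invertible CG (U.M.\<alpha> X)" and \<beta>: "invertible CG (U.M.\<beta> X)" if "X \<in> Ob CG" for X
      using equivalence_imp_invertible[OF equiv, of "fst X"] that
      by (auto intro: CG_\<alpha>_invertible CG_\<beta>_invertible)
    then have "dualizing CG (S_coalg unit_coalg) S_coalg \<pi>_coalg"
      by (rule U.M.invertible_imp_dualizing)
    then show ?thesis
      unfolding star_autonomous_def
      using U.preserves_left_homs[OF \<alpha>] U.preserves_right_homs[OF \<beta>] by blast
  qed
qed

end
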